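(* Let the parameters $(\mathsf R,\mathsf S,\mathsf P,\mathsf k_1)$ be admissible and let $\mathscr N_{\mathbf u}^M\subseteq\mathscr N_{\mathbf u}$, $\mathscr N_\theta^M\subseteq\mathscr N_\theta$ be finite index sets. For an initial condition $\mathbf X_0^M=(\mathbf u_0^M,\theta_0^M)$ in the span of the corresponding basis functions, let $\mathbf X^M(t)=(\mathbf u^M(t),\theta^M(t))$ be the solution of the truncated model with $\mathbf X^M(0)=\mathbf X_0^M$, and let $\boldsymbol\omega^M:=\nabla\times\mathbf u^M$. Then the vorticity balance $$\frac{d}{dt}\langle\boldsymbol\omega^M\rangle=\mathsf P\langle\partial_{x_3}^2\boldsymbol\omega^M\rangle+\langle(\boldsymbol\omega^M\cdot\nabla)\mathbf u^M\rangle+\mathsf P\mathsf S\langle\partial_{x_3}\mathbf u^M\rangle$$ holds (for all initial conditions $\mathbf X_0^M$) if and only if the Vorticity Criteria (i) and (ii) are satisfied.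
   Context: Parameters $(\mathsf R,\mathsf S,\mathsf P,\mathsf k_1)$ are admissible if $\mathsf R,\mathsf S\ge0$ and $\mathsf P,\mathsf k_1>0$. $\Omega=[0,2\pi/\mathsf k_1]\times[0,\pi]$ with coordinates $\mathbf x=(x_1,x_3)$; all functions are periodic in $x_1$ and independent of $x_2$ (so $\partial_{x_2}=0$); velocity fields have three components $\mathbf u=(u_1,u_2,u_3)$. $\langle f\rangle:=\int_\Omega f\,d\mathbf x$; $\hat{\mathbf e}^j$ are the unit vectors. Basis. Let $|\mathcal K\mathbf m|=(\mathsf k_1^2m_1^2+m_3^2)^{1/2}$, $V=(\pi^2/(2\mathsf k_1))^{1/2}$, $\eta^{\mathbf m}=\eta^{m_1}\eta^{m_3}$ with $\eta^m=1$ if $m>0$, $\eta^0=1/\sqrt2$. An index is $\mathbf n=(m_1,m_3,p_1,c)$, with wave vector $\mathbf m=(m_1,m_3)$, phase $p_1\in\{1,2\}$ and component $c\in\{1,2\}$; arithmetic with phases and components is mod $2$ (representatives in $\{1,2\}$). Set $f^{(\mathbf m,1,1)}=\frac{\eta^{\mathbf m}}V\cos(\mathsf k_1m_1x_1)\sin(m_3x_3)$, $f^{(\mathbf m,2,1)}=\frac{\eta^{\mathbf m}}V\sin(\mathsf k_1m_1x_1)\sin(m_3x_3)$, $\mathbf v^{(\mathbf m,1,1)}=\frac{\eta^{\mathbf m}}{|\mathcal K\mathbf m|V}\big(m_3\sin(\mathsf k_1m_1x_1)\cos(m_3x_3),\,0,\,-\mathsf k_1m_1\cos(\mathsf k_1m_1x_1)\sin(m_3x_3)\big)$,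 $\mathbf v^{(\mathbf m,2,1)}=\frac{\eta^{\mathbf m}}{|\mathcal K\mathbf m|V}\big(m_3\cos(\mathsf k_1m_1x_1)\cos(m_3x_3),\,0,\,\mathsf k_1m_1\sin(\mathsf k_1m_1x_1)\sin(m_3x_3)\big)$, $\mathbf v^{(\mathbf m,1,2)}=\frac{\eta^{\mathbf m}}V\hat{\mathbf e}^2\sin(\mathsf k_1m_1x_1)\cos(m_3x_3)$, $\mathbf v^{(\mathbf m,2,2)}=\frac{\eta^{\mathbf m}}V\hat{\mathbf e}^2\cos(\mathsf k_1m_1x_1)\cos(m_3x_3)$. $\mathscr N_\theta$ is the set of $(m_1,m_3,p_1,1)$ with $m_1\ge0$, $m_3\ge1$ integers, $p_1\in\{1,2\}$ if $m_1>0$ and $p_1=1$ if $m_1=0$. $\mathscr N_{\mathbf u}$ is the set of $(m_1,m_3,p_1,c)$ with $(m_1,m_3)\in\mathbb Z_{\ge0}^2\setminus\{\mathbf 0\}$, $p_1\in\{1,2\}$ if $m_1>0$ and $p_1=2$ if $m_1=0$, $c\in\{1,2\}$ if $m_3>0$ and $c=2$ if $m_3=0$. These functions are orthonormal in $L^2(\Omega)$. Truncated model. With $\mathcal P^M_{\mathbf u}[\mathbf w]=\sum_{\mathbf n\in\mathscr N^M_{\mathbf u}}\langle\mathbf w\cdot\mathbf v^{\mathbf n}\rangle\mathbf v^{\mathbf n}$ and $\mathcal P^M_\theta[g]=\sum_{\mathbf n\in\mathscr N^M_\theta}\langle gf^{\mathbf n}\rangle f^{\mathbf n}$, the truncated model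 is the finite-dimensional ODE for $\mathbf u^M=\sum_{\mathbf n\in\mathscr N_{\mathbf u}^M}u^{\mathbf n,M}(t)\mathbf v^{\mathbf n}$, $\theta^M=\sum_{\mathbf n\in\mathscr N_\theta^M}\theta^{\mathbf n,M}(t)f^{\mathbf n}$: $$\partial_t\mathbf u^M=\mathsf P\Delta\mathbf u^M+\mathsf P\mathsf R\,\mathcal P^M_{\mathbf u}[\theta^M\hat{\mathbf e}^3]-\mathsf P\mathsf S\,\mathcal P^M_{\mathbf u}[\hat{\mathbf e}^3\times\mathbf u^M]-\mathcal P^M_{\mathbf u}[\mathbf u^M\cdot\nabla\mathbf u^M],$$ $$\partial_t\theta^M=\Delta\theta^M+\mathcal P^M_\theta[u_3^M]-\mathcal P^M_\theta[\mathbf u^M\cdot\nabla\theta^M].$$ Vorticity Criteria. (i) Whenever $\mathbf n'=(m_1',m_3',p',c')$ and $\mathbf n''=(m_1'',m_3'',p'',c'')$ in $\mathscr N_{\mathbf u}^M$ satisfy $m_1'=m_1''>0$, $m_3'+m_3''$ odd and $p'=p''+1$ (mod 2): if $c'=c''=1$, then $(0,|m_3'-m_3''|,2,1)\in\mathscr N_{\mathbf u}^M$ if and only if $(0,m_3'+m_3'',2,1)\in\mathscr N_{\mathbf u}^M$; if $(c',c'')=(1,2)$ or $(2,1)$, then both $(0,m_3'+m_3'',2,2)$ and $(0,|m_3'-m_3''|,2,2)$ belong to $\mathscr N_{\mathbf u}^M$. (ii) If $\mathsf S\ne0$ and $m_3>0$ is odd, then $(0,m_3,p_1,c)\in\mathscr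 N_{\mathbf u}^M$ implies $(0,m_3,p_1,c+1)\in\mathscr N_{\mathbf u}^M$. *)

theory Defs
  imports "HOL-Analysis.Analysis"
begin

section \<open>Fields on the two-dimensional domain\<close>

text \<open>
  A point \<open>(x\<^sub>1, x\<^sub>3)\<close> is a pair of reals. Nothing depends on \<open>x\<^sub>2\<close>, so every term with a
  derivative in \<open>x\<^sub>2\<close> is dropped; vectors nevertheless have three components. All fields below are
  trigonometric polynomials on the whole plane, so the partial derivatives are two-sided also at
  the boundary of the domain.
\<close>

type_synonym 'b field = "real \<times> real \<Rightarrow> 'b"

definition admissible :: "real \<Rightarrow> real \<Rightarrow> real \<Rightarrow> real \<Rightarrow> bool" where
  "admissible R S P k1 \<longleftrightarrow> R \<ge> 0 \<and> S \<ge> 0 \<and> P > 0 \<and> k1 > 0"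

definition Omega :: "real \<Rightarrow> (real \<times> real) set" where
  "Omega k1 = {0 .. 2 * pi / k1} \<times> {0 .. pi}"

definition bracket :: "real \<Rightarrow> 'b::banach field \<Rightarrow> 'b" where
  "bracket k1 f = integral (Omega k1) f"

definition d1 :: "'b::real_normed_vector field \<Rightarrow> 'b field" where
  "d1 f = (\<lambda>(x1, x3). vector_derivative (\<lambda>s. f (s, x3)) (at x1))"

definition d3 :: "'b::real_normed_vector field \<Rightarrow> 'b field" where
  "d3 f = (\<lambda>(x1, x3). vector_derivative (\<lambda>s. f (x1, s)) (at x3))"

definition laplacian :: "'b::real_normed_vector field \<Rightarrow> 'b field" where
  "laplacian f = (\<lambda>x. d1 (d1 f) x + d3 (d3 f) x)"

text \<open>The operator \<open>(w \<bullet> \<nabla>) f\<close>, for scalar or vector valued \<open>f\<close>.\<close>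

definition advect :: "(real^3) field \<Rightarrow> 'b::real_normed_vector field \<Rightarrow> 'b field" where
  "advect w f = (\<lambda>x. (w x $ 1) *\<^sub>R d1 f x + (w x $ 3) *\<^sub>R d3 f x)"

definition curl :: "(real^3) field \<Rightarrow> (real^3) field" where
  "curl u = (\<lambda>x. vector [- (d3 u x $ 2), d3 u x $ 1 - d1 u x $ 3, d1 u x $ 2])"

abbreviation e2 :: "real^3" where "e2 \<equiv> axis 2 1"
abbreviation e3 :: "real^3" where "e3 \<equiv> axis 3 1"

section \<open>Basis functions\<close>

text \<open>An index \<open>(m\<^sub>1, m\<^sub>3, p\<^sub>1, c)\<close>: wave vector, phase and component, the last two in \<open>{1, 2}\<close>.\<close>

type_synonym mode = "int \<times> int \<times> int \<times> int"

text \<open>The representative in \<open>{1, 2}\<close> of an integer modulo 2.\<close>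

definition rep2 :: "int \<Rightarrow> int" where
  "rep2 k = (if odd k then 1 else 2)"

definition eta1 :: "int \<Rightarrow> real" where
  "eta1 m = (if m = 0 then 1 / sqrt 2 else 1)"

definition eta :: "int \<Rightarrow> int \<Rightarrow> real" where
  "eta m1 m3 = eta1 m1 * eta1 m3"

definition Vnorm :: "real \<Rightarrow> real" where
  "Vnorm k1 = sqrt (pi\<^sup>2 / (2 * k1))"

definition Knorm :: "real \<Rightarrow> int \<Rightarrow> int \<Rightarrow> real" where
  "Knorm k1 m1 m3 = sqrt (k1\<^sup>2 * (of_int m1)\<^sup>2 + (of_int m3)\<^sup>2)"

text \<open>
  In the next two definitions the final \<open>else\<close> branches stand for phase 2 and component 2; other
  values do not occur in the admissible index sets.
\<close>

fun fbasis :: "real \<Rightarrow> mode \<Rightarrow> real field" where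
  "fbasis k1 (m1, m3, p, c) = (\<lambda>(x1, x3).
     eta m1 m3 / Vnorm k1 *
       (if p = 1 then cos (k1 * of_int m1 * x1) else sin (k1 * of_int m1 * x1)) *
       sin (of_int m3 * x3))"

fun vbasis :: "real \<Rightarrow> mode \<Rightarrow> (real^3) field" where
  "vbasis k1 (m1, m3, p, c) = (\<lambda>(x1, x3).
     if c = 1 then
       (eta m1 m3 / (Knorm k1 m1 m3 * Vnorm k1)) *\<^sub>R
         (if p = 1 then
            vector [of_int m3 * sin (k1 * of_int m1 * x1) * cos (of_int m3 * x3),
                    0,
                    - (k1 * of_int m1 * cos (k1 * of_int m1 * x1) * sin (of_int m3 * x3))]
          else
            vector [of_int m3 * cos (k1 * of_int m1 * x1) * cos (of_int m3 * x3),
                    0,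
                    k1 * of_int m1 * sin (k1 * of_int m1 * x1) * sin (of_int m3 * x3)])
     else
       (eta m1 m3 / Vnorm k1 *
         (if p = 1 then sin (k1 * of_int m1 * x1) else cos (k1 * of_int m1 * x1)) *
         cos (of_int m3 * x3)) *\<^sub>R e2)"

definition Ntheta :: "mode set" where
  "Ntheta = {(m1, m3, p, c). m1 \<ge> 0 \<and> m3 \<ge> 1 \<and> c = 1 \<and>
     (if m1 > 0 then p \<in> {1, 2} else p = 1)}"

definition Nu :: "mode set" where
  "Nu = {(m1, m3, p, c). m1 \<ge> 0 \<and> m3 \<ge> 0 \<and> (m1, m3) \<noteq> (0, 0) \<and>
     (if m1 > 0 then p \<in> {1, 2} else p = 2) \<and>
     (if m3 > 0 then c \<in> {1, 2} else c = 2)}"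

section \<open>The truncated model\<close>

definition vexpand :: "real \<Rightarrow> mode set \<Rightarrow> (mode \<Rightarrow> real) \<Rightarrow> (real^3) field" where
  "vexpand k1 N a = (\<lambda>x. \<Sum>n\<in>N. a n *\<^sub>R vbasis k1 n x)"

definition fexpand :: "real \<Rightarrow> mode set \<Rightarrow> (mode \<Rightarrow> real) \<Rightarrow> real field" where
  "fexpand k1 N b = (\<lambda>x. \<Sum>n\<in>N. b n * fbasis k1 n x)"

definition vproj :: "real \<Rightarrow> mode set \<Rightarrow> (real^3) field \<Rightarrow> (real^3) field" where
  "vproj k1 N w = vexpand k1 N (\<lambda>n. bracket k1 (\<lambda>x. w x \<bullet> vbasis k1 n x))"

definition fproj :: "real \<Rightarrow> mode set \<Rightarrow> real field \<Rightarrow> real field" where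
  "fproj k1 N g = fexpand k1 N (\<lambda>n. bracket k1 (\<lambda>x. g x * fbasis k1 n x))"

definition u_rhs ::
  "real \<Rightarrow> real \<Rightarrow> real \<Rightarrow> real \<Rightarrow> mode set \<Rightarrow> (real^3) field \<Rightarrow> real field \<Rightarrow> (real^3) field" where
  "u_rhs R S P k1 NuM u th = (\<lambda>x.
     P *\<^sub>R laplacian u x
     + (P * R) *\<^sub>R vproj k1 NuM (\<lambda>y. th y *\<^sub>R e3) x
     - (P * S) *\<^sub>R vproj k1 NuM (\<lambda>y. cross3 e3 (u y)) x
     - vproj k1 NuM (advect u u) x)"

definition th_rhs :: "real \<Rightarrow> mode set \<Rightarrow> (real^3) field \<Rightarrow> real field \<Rightarrow> real field" where
  "th_rhs k1 NthM u th = (\<lambda>x.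
     laplacian th x + fproj k1 NthM (\<lambda>y. u y $ 3) x - fproj k1 NthM (advect u th) x)"

text \<open>
  Solutions live on \<open>[0, T)\<close> with \<open>0 < T \<le> \<infinity>\<close>; time derivatives at \<open>0\<close> are one-sided.
\<close>

definition time_interval :: "ereal \<Rightarrow> real set" where
  "time_interval T = {t. 0 \<le> t \<and> ereal t < T}"

definition truncated_solution ::
  "real \<Rightarrow> real \<Rightarrow> real \<Rightarrow> real \<Rightarrow> mode set \<Rightarrow> mode set \<Rightarrow> ereal \<Rightarrow>
   (real \<Rightarrow> (real^3) field) \<Rightarrow> (real \<Rightarrow> real field) \<Rightarrow> bool" where
  "truncated_solution R S P k1 NuM NthM T u th \<longleftrightarrow>
     (\<exists>a b :: real \<Rightarrow> mode \<Rightarrow> real.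
        \<forall>t\<in>time_interval T.
          u t = vexpand k1 NuM (a t) \<and> th t = fexpand k1 NthM (b t) \<and>
          (\<forall>n\<in>NuM. (\<lambda>s. a s n) differentiable (at t within time_interval T)) \<and>
          (\<forall>n\<in>NthM. (\<lambda>s. b s n) differentiable (at t within time_interval T))) \<and>
     (\<forall>t\<in>time_interval T. \<forall>x\<in>Omega k1.
        ((\<lambda>s. u s x) has_vector_derivative u_rhs R S P k1 NuM (u t) (th t) x)
           (at t within time_interval T) \<and>
        ((\<lambda>s. th s x) has_real_derivative th_rhs k1 NthM (u t) (th t) x)
           (at t within time_interval T))"

section \<open>Vorticity balance and vorticity criteria\<close>

definition vorticity_balance ::
  "real \<Rightarrow> real \<Rightarrow> real \<Rightarrow> ereal \<Rightarrow> (real \<Rightarrow> (real^3) field) \<Rightarrow> bool" where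
  "vorticity_balance S P k1 T u \<longleftrightarrow>
     (\<forall>t\<in>time_interval T.
        ((\<lambda>s. bracket k1 (curl (u s))) has_vector_derivative
           (P *\<^sub>R bracket k1 (d3 (d3 (curl (u t))))
            + bracket k1 (advect (curl (u t)) (u t))
            + (P * S) *\<^sub>R bracket k1 (d3 (u t))))
        (at t within time_interval T))"

definition vorticity_criterion_i :: "mode set \<Rightarrow> bool" where
  "vorticity_criterion_i NuM \<longleftrightarrow>
     (\<forall>m1' m3' p' c' m1'' m3'' p'' c''.
        (m1', m3', p', c') \<in> NuM \<and> (m1'', m3'', p'', c'') \<in> NuM \<and>
        m1' = m1'' \<and> m1'' > 0 \<and> odd (m3' + m3'') \<and> p' = rep2 (p'' + 1) \<longrightarrow>
        (c' = 1 \<and> c'' = 1 \<longrightarrow>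
           ((0, \<bar>m3' - m3''\<bar>, 2, 1) \<in> NuM \<longleftrightarrow> (0, m3' + m3'', 2, 1) \<in> NuM)) \<and>
        ((c', c'') \<in> {(1, 2), (2, 1)} \<longrightarrow>
           (0, m3' + m3'', 2, 2) \<in> NuM \<and> (0, \<bar>m3' - m3''\<bar>, 2, 2) \<in> NuM))"

definition vorticity_criterion_ii :: "real \<Rightarrow> mode set \<Rightarrow> bool" where
  "vorticity_criterion_ii S NuM \<longleftrightarrow>
     (S \<noteq> 0 \<longrightarrow>
       (\<forall>m3 p c. m3 > 0 \<and> odd m3 \<and> (0, m3, p, c) \<in> NuM \<longrightarrow> (0, m3, p, rep2 (c + 1)) \<in> NuM))"

end

theory Submission
  imports Defs
begin

text \<open>
  By periodicity and impermeability only the modes \<open>(0, m\<^sub>3, 2, c)\<close> with \<open>m\<^sub>3\<close> odd contribute to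
  \<open>\<langle>\<omega>\<rangle>\<close>, and on these modes diffusion and buoyancy always balance. Inserting the coefficient equations
  into \<open>d/dt \<langle>\<omega>\<rangle>\<close> leaves a defect: a linear part, summing the odd mean modes whose Coriolis
  partner is missing, and two quadratic forms, which collect the interactions of two modes with equal
  \<open>m\<^sub>1 > 0\<close> and opposite phase whose sum or difference frequency has been cut off by the projection.
  The criteria make each of these contributions vanish. Conversely, the balance at time \<open>0\<close> of solutions
  that start from a single mode or from a pair of modes isolates the individual contributions; such
  solutions exist locally, since a quadratic system is solved by its Taylor series.
\<close>

section \<open>Quadratic ordinary differential equations\<close>

text \<open>The defect is a single vector in which the Coriolis part and the quadratic parts
  overlap, so its vanishing gives no separate conditions at once. The horizontal wave number
  separates them: a mode does not interact with itself, which leaves only the Coriolis part for one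
  mean mode, whereas two modes with positive horizontal wave number have no Coriolis defect. The
  shape of criterion (i) comes from symmetry. Let a, b be the vertical wave numbers of a pair; the
  transfer has weight a + b at the sum and a - b at the difference frequency. Between two modes of
  component 1 only the symmetrized part counts. It is (a + b)(a - b) times the difference of the two
  membership indicators, so both frequencies must be kept or both dropped. Between a mode of
  component 1 (wave number a) and one of component 2 (wave number b), vortex stretching demands 2a =
  (a + b) + (a - b), which forces both to be kept.\<close>

text \<open>
  The Taylor coefficients of a solution. Dividing the \<open>n + 1\<close> terms of the Cauchy product by \<open>Suc n\<close>
  makes a geometric bound stable under the recursion.
\<close>

fun taylor_coeff :: "'i set \<Rightarrow> ('i \<Rightarrow> 'i \<Rightarrow> real) \<Rightarrow> ('i \<Rightarrow> 'i \<Rightarrow> 'i \<Rightarrow> real) \<Rightarrow> ('i \<Rightarrow> real) \<Rightarrow>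
    nat \<Rightarrow> 'i \<Rightarrow> real" where
  "taylor_coeff I A Q y0 0 i = y0 i"
| "taylor_coeff I A Q y0 (Suc n) i =
     ((\<Sum>j\<in>I. A i j * taylor_coeff I A Q y0 n j) +
      (\<Sum>j\<in>I. \<Sum>l\<in>I. Q i j l *
        (\<Sum>k\<le>n. taylor_coeff I A Q y0 k j * taylor_coeff I A Q y0 (n - k) l))) / Suc n"

text \<open>Let K = M (1 + r). In the recursion the linear part is at most M r K^n, and each of the
  n + 1 products in the convolution is at most r^2 K^n. After division by n + 1 the two parts add up
  to at most M (r + r^2) K^n = r K^(n + 1).\<close>

lemma taylor_coeff_bound:
  assumes M: "\<And>i. i \<in> I \<Longrightarrow> (\<Sum>j\<in>I. \<bar>A i j\<bar>) \<le> M"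
             "\<And>i. i \<in> I \<Longrightarrow> (\<Sum>j\<in>I. \<Sum>l\<in>I. \<bar>Q i j l\<bar>) \<le> M"
    and r: "\<And>i. i \<in> I \<Longrightarrow> \<bar>y0 i\<bar> \<le> r" and "r \<ge> 0" "M \<ge> 0" "i \<in> I"
  shows "\<bar>taylor_coeff I A Q y0 n i\<bar> \<le> r * (M * (1 + r)) ^ n"
  using \<open>i \<in> I\<close>
proof (induction n arbitrary: i rule: less_induct)
  case (less n)
  let ?c = "taylor_coeff I A Q y0" and ?K = "M * (1 + r)"
  show ?case
  proof (cases n)
    case 0
    then show ?thesis using r less.prems by simp
  next
    case (Suc n')
    have K: "?K \<ge> 0" using assms by simp
    have lin: "\<bar>\<Sum>j\<in>I. A i j * ?c n' j\<bar> \<le> M * (r * ?K ^ n')"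
    proof -
      have "\<bar>\<Sum>j\<in>I. A i j * ?c n' j\<bar> \<le> (\<Sum>j\<in>I. \<bar>A i j\<bar> * (r * ?K ^ n'))"
        using less.IH Suc by (intro order.trans[OF sum_abs] sum_mono) (simp add: abs_mult mult_left_mono)
      also have "\<dots> \<le> M * (r * ?K ^ n')"
        unfolding sum_distrib_right[symmetric] using M(1)[OF less.prems] K assms
        by (intro mult_right_mono) auto
      finally show ?thesis .
    qed
    have conv: "\<bar>\<Sum>k\<le>n'. ?c k j * ?c (n' - k) l\<bar> \<le> Suc n' * (r * r * ?K ^ n')"
      if "j \<in> I" "l \<in> I" for j l
    proof -
      have "\<bar>?c k j * ?c (n' - k) l\<bar> \<le> r * r * ?K ^ n'" if "k \<le> n'" for k
      proof -
        have "\<bar>?c k j * ?c (n' - k) l\<bar> \<le> (r * ?K ^ k) * (r * ?K ^ (n' - k))"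
          unfolding abs_mult using less.IH Suc that \<open>j \<in> I\<close> \<open>l \<in> I\<close> K \<open>r \<ge> 0\<close>
          by (intro mult_mono) auto
        also have "\<dots> = r * r * ?K ^ (k + (n' - k))"
          unfolding power_add by (simp only: mult_ac)
        finally show ?thesis using that by simp
      qed
      then have "\<bar>\<Sum>k\<le>n'. ?c k j * ?c (n' - k) l\<bar> \<le> (\<Sum>k\<le>n'. r * r * ?K ^ n')"
        by (intro order.trans[OF sum_abs] sum_mono) auto
      then show ?thesis by simp
    qed
    have "\<bar>\<Sum>j\<in>I. \<Sum>l\<in>I. Q i j l * (\<Sum>k\<le>n'. ?c k j * ?c (n' - k) l)\<bar>
        \<le> (\<Sum>j\<in>I. \<Sum>l\<in>I. \<bar>Q i j l\<bar> * (Suc n' * (r * r * ?K ^ n')))"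
      using conv by (intro order.trans[OF sum_abs] sum_mono) (simp add: abs_mult mult_left_mono)
    also have "\<dots> = (\<Sum>j\<in>I. \<Sum>l\<in>I. \<bar>Q i j l\<bar>) * (Suc n' * (r * r * ?K ^ n'))"
      by (simp only: sum_distrib_right)
    also have "\<dots> \<le> M * (Suc n' * (r * r * ?K ^ n'))"
      using M(2)[OF less.prems] K assms by (intro mult_right_mono) auto
    finally have quad: "\<bar>\<Sum>j\<in>I. \<Sum>l\<in>I. Q i j l * (\<Sum>k\<le>n'. ?c k j * ?c (n' - k) l)\<bar>
        \<le> M * (Suc n' * (r * r * ?K ^ n'))" .
    \<comment> \<open>The linear part is enlarged by the factor \<open>Suc n'\<close>, so that the
      division in the recursion cancels it in both parts.\<close>
    have "M * (r * ?K ^ n') * 1 \<le> M * (r * ?K ^ n') * Suc n'"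
      using K assms by (intro mult_left_mono) auto
    with lin quad have "\<bar>(\<Sum>j\<in>I. A i j * ?c n' j) +
        (\<Sum>j\<in>I. \<Sum>l\<in>I. Q i j l * (\<Sum>k\<le>n'. ?c k j * ?c (n' - k) l))\<bar>
        \<le> M * (r * ?K ^ n') * Suc n' + M * (Suc n' * (r * r * ?K ^ n'))"
      by linarith
    also have "\<dots> = r * ?K ^ Suc n' * Suc n'"
      by (simp add: algebra_simps)
    finally show ?thesis
      unfolding Suc taylor_coeff.simps by (simp add: abs_divide divide_le_eq)
  qed
qed

text \<open>The geometric bound makes the series absolutely convergent up to |t| = T. It may
  therefore be differentiated termwise, and the quadratic terms are Cauchy products; the recursion
  is the comparison of the coefficients of t^n.\<close>

lemma quadratic_ode_local_solution:
  fixes A :: "'i \<Rightarrow> 'i \<Rightarrow> real" and Q :: "'i \<Rightarrow> 'i \<Rightarrow> 'i \<Rightarrow> real" and y0 :: "'i \<Rightarrow> real"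
  assumes "finite I"
  obtains T :: real and y :: "real \<Rightarrow> 'i \<Rightarrow> real" where "T > 0" "y 0 = y0"
    "\<And>t i. i \<in> I \<Longrightarrow> \<bar>t\<bar> < T \<Longrightarrow> ((\<lambda>s. y s i) has_real_derivative
       (\<Sum>j\<in>I. A i j * y t j) + (\<Sum>j\<in>I. \<Sum>l\<in>I. Q i j l * (y t j * y t l))) (at t)"
proof -
  \<comment> \<open>Total sums dominate every entry of \<open>y0\<close> and every row sum of
    \<open>A\<close> and \<open>Q\<close> at once.\<close>
  define r where "r = (\<Sum>i\<in>I. \<bar>y0 i\<bar>)"
  define M where "M = (\<Sum>i\<in>I. \<Sum>j\<in>I. \<bar>A i j\<bar>) + (\<Sum>i\<in>I. \<Sum>j\<in>I. \<Sum>l\<in>I. \<bar>Q i j l\<bar>)"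
  define c where "c = taylor_coeff I A Q y0"
  define y where "y = (\<lambda>t i. \<Sum>n. c n i * t ^ n)"
  define K where "K = M * (1 + r)"
  \<comment> \<open>The summand 1 keeps the denominator positive when K = 0 and makes K * T strictly
    less than 1.\<close>
  define T where "T = 1 / (K + 1)"
  have r0: "r \<ge> 0" and M0: "M \<ge> 0" by (auto simp: r_def M_def intro!: sum_nonneg add_nonneg_nonneg)
  then have K0: "K \<ge> 0" by (simp add: K_def)
  then have T0: "T > 0" by (simp add: T_def)
  have bound: "\<bar>c n i\<bar> \<le> r * K ^ n" if "i \<in> I" for n i
    unfolding c_def K_def
  proof (rule taylor_coeff_bound)
    fix i assume i: "i \<in> I"
    show "\<bar>y0 i\<bar> \<le> r" unfolding r_def using i \<open>finite I\<close> by (intro member_le_sum) auto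
    have 1: "(\<Sum>j\<in>I. \<bar>A i j\<bar>) \<le> (\<Sum>i\<in>I. \<Sum>j\<in>I. \<bar>A i j\<bar>)"
      using i \<open>finite I\<close> by (intro member_le_sum[of i I "\<lambda>i. \<Sum>j\<in>I. \<bar>A i j\<bar>"]) (auto intro: sum_nonneg)
    have 2: "(\<Sum>j\<in>I. \<Sum>l\<in>I. \<bar>Q i j l\<bar>) \<le> (\<Sum>i\<in>I. \<Sum>j\<in>I. \<Sum>l\<in>I. \<bar>Q i j l\<bar>)"
      using i \<open>finite I\<close>
      by (intro member_le_sum[of i I "\<lambda>i. \<Sum>j\<in>I. \<Sum>l\<in>I. \<bar>Q i j l\<bar>"]) (auto intro!: sum_nonneg)
    have 3: "(\<Sum>i\<in>I. \<Sum>j\<in>I. \<bar>A i j\<bar>) \<ge> 0" "(\<Sum>i\<in>I. \<Sum>j\<in>I. \<Sum>l\<in>I. \<bar>Q i j l\<bar>) \<ge> 0"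
      by (intro sum_nonneg; simp)+
    show "(\<Sum>j\<in>I. \<bar>A i j\<bar>) \<le> M" "(\<Sum>j\<in>I. \<Sum>l\<in>I. \<bar>Q i j l\<bar>) \<le> M"
      using 1 2 3 unfolding M_def by linarith+
  qed (use r0 M0 that in auto)
  have summ: "summable (\<lambda>n. \<bar>c n i * t ^ n\<bar>)" if "i \<in> I" "\<bar>t\<bar> \<le> T" for i t
  proof (rule summable_comparison_test'[where N = 0])
    have "K * T < 1" using K0 by (simp add: T_def divide_less_eq)
    then show "summable (\<lambda>n. r * (K * T) ^ n)"
      using K0 T0 by (intro summable_mult summable_geometric) auto
    show "norm \<bar>c n i * t ^ n\<bar> \<le> r * (K * T) ^ n" for n
    proof -
      have "\<bar>c n i\<bar> * \<bar>t\<bar> ^ n \<le> (r * K ^ n) * T ^ n"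
        using bound[OF \<open>i \<in> I\<close>] that r0 K0 by (intro mult_mono power_mono) auto
      then show ?thesis by (simp add: abs_mult power_abs power_mult_distrib mult.assoc)
    qed
  qed
  have sums: "(\<lambda>n. c n i * t ^ n) sums y t i" if "i \<in> I" "\<bar>t\<bar> \<le> T" for i t
    unfolding y_def using summable_rabs_cancel[OF summ[OF that]] by (rule summable_sums)
  show ?thesis
  proof
    show "T > 0" by fact
    show "y 0 = y0" unfolding y_def c_def by (auto simp: powser_zero)
    fix t i assume i: "i \<in> I" and t: "\<bar>t\<bar> < T"
    have "DERIV (\<lambda>x. \<Sum>n. c n i * x ^ n) t :> (\<Sum>n. diffs (\<lambda>n. c n i) n * t ^ n)"
      by (rule termdiffs_strong[where K = T])
        (use i t T0 summable_rabs_cancel[OF summ[OF i]] in auto)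
    moreover have "(\<lambda>n. diffs (\<lambda>n. c n i) n * t ^ n) sums
       ((\<Sum>j\<in>I. A i j * y t j) + (\<Sum>j\<in>I. \<Sum>l\<in>I. Q i j l * (y t j * y t l)))"
    proof -
      have prod': "(\<lambda>n. \<Sum>k\<le>n. (c k j * t ^ k) * (c (n - k) l * t ^ (n - k))) sums (y t j * y t l)"
        if "j \<in> I" "l \<in> I" for j l
        unfolding y_def using that t by (intro Cauchy_product_sums) (auto intro: summ)
      have prod: "(\<lambda>n. (\<Sum>k\<le>n. c k j * c (n - k) l) * t ^ n) sums (y t j * y t l)"
        if "j \<in> I" "l \<in> I" for j l
      proof -
        have "(\<Sum>k\<le>n. (c k j * t ^ k) * (c (n - k) l * t ^ (n - k)))
            = (\<Sum>k\<le>n. c k j * c (n - k) l) * t ^ n" for n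
          unfolding sum_distrib_right
        proof (rule sum.cong)
          fix k assume "k \<in> {..n}"
          then have "t ^ n = t ^ k * t ^ (n - k)" by (simp flip: power_add)
          then show "(c k j * t ^ k) * (c (n - k) l * t ^ (n - k)) = c k j * c (n - k) l * t ^ n"
            by simp
        qed simp
        with prod'[OF that] show ?thesis by (simp only:)
      qed
      have "(\<lambda>n. (\<Sum>j\<in>I. A i j * (c n j * t ^ n)) +
          (\<Sum>j\<in>I. \<Sum>l\<in>I. Q i j l * ((\<Sum>k\<le>n. c k j * c (n - k) l) * t ^ n))) sums
          ((\<Sum>j\<in>I. A i j * y t j) + (\<Sum>j\<in>I. \<Sum>l\<in>I. Q i j l * (y t j * y t l)))"
        using t by (intro sums_add sums_sum sums_mult prod sums) auto
      moreover have "diffs (\<lambda>n. c n i) n * t ^ n = (\<Sum>j\<in>I. A i j * (c n j * t ^ n)) +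
          (\<Sum>j\<in>I. \<Sum>l\<in>I. Q i j l * ((\<Sum>k\<le>n. c k j * c (n - k) l) * t ^ n))" for n
        unfolding diffs_def c_def taylor_coeff.simps
        by (simp add: sum_distrib_right distrib_right mult.assoc del: of_nat_Suc)
      ultimately show ?thesis by (simp only:)
    qed
    ultimately show "((\<lambda>s. y s i) has_real_derivative
       (\<Sum>j\<in>I. A i j * y t j) + (\<Sum>j\<in>I. \<Sum>l\<in>I. Q i j l * (y t j * y t l))) (at t)"
      unfolding y_def by (simp add: sums_iff)
  qed
qed

section \<open>Trigonometric integrals\<close>

lemma has_integral_cos_int:
  "((\<lambda>z. cos (of_int q * z)) has_integral (if q = 0 then pi else 0)) {0..pi}"
proof (cases "q = 0")
  case True
  then show ?thesis using has_integral_const_real[of "1::real" 0 pi] by simp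
next
  case False
  have "((\<lambda>z. cos (of_int q * z)) has_integral
      sin (of_int q * pi) / of_int q - sin (of_int q * 0) / of_int q) {0..pi}"
    using False
    by (intro fundamental_theorem_of_calculus)
       (auto intro!: derivative_eq_intros simp flip: has_real_derivative_iff_has_vector_derivative)
  moreover have "sin (real_of_int q * pi) = 0" by (simp add: sin_zero_iff_int2)
  ultimately show ?thesis using False by simp
qed

lemma cos_int_pi: "cos (real_of_int q * pi) = (if odd q then -1 else 1)"
  using cos_int_times_real[of q pi] by (simp add: mult.commute cos_integer_2pi)

lemma has_integral_sin_int:
  "((\<lambda>z. sin (of_int q * z)) has_integral (if odd q then 2 / of_int q else 0)) {0..pi}"
proof (cases "q = 0")
  case True
  then show ?thesis by simp
next
  case False
  have "((\<lambda>z. sin (of_int q * z)) has_integral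
      (- cos (of_int q * pi) / of_int q) - (- cos (of_int q * 0) / of_int q)) {0..pi}"
    using False
    by (intro fundamental_theorem_of_calculus)
       (auto intro!: derivative_eq_intros simp flip: has_real_derivative_iff_has_vector_derivative)
  then show ?thesis using False by (auto simp: cos_int_pi split: if_splits)
qed

lemma sin_int_period:
  assumes "k > 0" shows "sin (k * real_of_int q * (2 * pi / k)) = 0"
  using assms sin_zero_iff_int2[of "k * real_of_int q * (2 * pi / k)"]
  by (auto intro!: exI[of _ "2 * q"])

lemma cos_int_period:
  assumes "k > 0" shows "cos (k * real_of_int q * (2 * pi / k)) = 1"
proof -
  have "k * real_of_int q * (2 * pi / k) = real_of_int (2 * q) * pi" using assms by simp
  then show ?thesis by (simp only: cos_int_pi) simp
qed

lemma has_integral_cos_period: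
  assumes "k > 0"
  shows "((\<lambda>x. cos (k * of_int q * x)) has_integral (if q = 0 then 2 * pi / k else 0)) {0..2 * pi / k}"
proof (cases "q = 0")
  case True
  then show ?thesis using has_integral_const_real[of "1::real" 0 "2 * pi / k"] assms by simp
next
  case False
  have "((\<lambda>x. cos (k * of_int q * x)) has_integral
      sin (k * of_int q * (2 * pi / k)) / (k * of_int q) - sin (k * of_int q * 0) / (k * of_int q))
      {0..2 * pi / k}"
    using False assms
    by (intro fundamental_theorem_of_calculus)
       (auto intro!: derivative_eq_intros simp flip: has_real_derivative_iff_has_vector_derivative)
  then show ?thesis using False sin_int_period[OF assms, of q] by simp
qed

lemma has_integral_sin_period:
  assumes "k > 0"
  shows "((\<lambda>x. sin (k * of_int q * x)) has_integral 0) {0..2 * pi / k}"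
proof (cases "q = 0")
  case True
  then show ?thesis by simp
next
  case False
  have "((\<lambda>x. sin (k * of_int q * x)) has_integral
      (- cos (k * of_int q * (2 * pi / k)) / (k * of_int q)) - (- cos (k * of_int q * 0) / (k * of_int q)))
      {0..2 * pi / k}"
    using False assms
    by (intro fundamental_theorem_of_calculus)
       (auto intro!: derivative_eq_intros simp flip: has_real_derivative_iff_has_vector_derivative)
  then show ?thesis using False cos_int_period[OF assms, of q] by simp
qed

text \<open>Product-to-sum gives the frequencies a + b + m, a + b - m, a - b + m and a - b - m. The
  signs of a, b, m exclude a zero of the first; the last two cannot vanish together, and they merge
  into |a - b| = m.\<close>

lemma has_integral_cos_cos_cos:
  fixes a b m :: int
  assumes "m > 0" "a \<ge> 0" "b \<ge> 0"
  shows "((\<lambda>z. cos (of_int a * z) * cos (of_int b * z) * cos (of_int m * z)) has_integral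
    pi / 4 * (of_bool (a + b = m) + of_bool (\<bar>a - b\<bar> = m))) {0..pi}"
proof -
  have "((\<lambda>z. (cos (of_int (a + b + m) * z) + cos (of_int (a + b - m) * z)
      + cos (of_int (a - b + m) * z) + cos (of_int (a - b - m) * z)) / 4) has_integral
      ((if a + b + m = 0 then pi else 0) + (if a + b - m = 0 then pi else 0)
      + (if a - b + m = 0 then pi else 0) + (if a - b - m = 0 then pi else 0)) / 4) {0..pi}"
    by (intro has_integral_divide has_integral_add has_integral_cos_int)
  moreover have "((if a + b + m = 0 then pi else 0) + (if a + b - m = 0 then pi else 0)
      + (if a - b + m = 0 then pi else 0) + (if a - b - m = 0 then pi else 0)) / 4
      = pi / 4 * (of_bool (a + b = m) + of_bool (\<bar>a - b\<bar> = m))"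
    using assms by (auto simp: of_bool_def abs_if)
  moreover have "(cos (of_int (a + b + m) * z) + cos (of_int (a + b - m) * z)
      + cos (of_int (a - b + m) * z) + cos (of_int (a - b - m) * z)) / 4
      = cos (of_int a * z) * cos (of_int b * z) * cos (of_int m * z)" for z :: real
    unfolding of_int_add of_int_diff left_diff_distrib distrib_right cos_add cos_diff sin_add sin_diff
    by (simp add: field_simps)
  ultimately show ?thesis by (simp only:)
qed

lemma has_integral_sin_sin_cos:
  fixes a b m :: int
  assumes "m > 0" "a \<ge> 0" "b \<ge> 0"
  shows "((\<lambda>z. sin (of_int a * z) * sin (of_int b * z) * cos (of_int m * z)) has_integral
    pi / 4 * (of_bool (\<bar>a - b\<bar> = m) - of_bool (a + b = m))) {0..pi}"
proof -
  have "((\<lambda>z. (cos (of_int (a - b + m) * z) + cos (of_int (a - b - m) * z)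
      - cos (of_int (a + b + m) * z) - cos (of_int (a + b - m) * z)) / 4) has_integral
      ((if a - b + m = 0 then pi else 0) + (if a - b - m = 0 then pi else 0)
      - (if a + b + m = 0 then pi else 0) - (if a + b - m = 0 then pi else 0)) / 4) {0..pi}"
    by (intro has_integral_divide has_integral_add has_integral_diff has_integral_cos_int)
  moreover have "((if a - b + m = 0 then pi else 0) + (if a - b - m = 0 then pi else 0)
      - (if a + b + m = 0 then pi else 0) - (if a + b - m = 0 then pi else 0)) / 4
      = pi / 4 * (of_bool (\<bar>a - b\<bar> = m) - of_bool (a + b = m))"
    using assms by (auto simp: of_bool_def abs_if)
  moreover have "(cos (of_int (a - b + m) * z) + cos (of_int (a - b - m) * z)
      - cos (of_int (a + b + m) * z) - cos (of_int (a + b - m) * z)) / 4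
      = sin (of_int a * z) * sin (of_int b * z) * cos (of_int m * z)" for z :: real
    unfolding of_int_add of_int_diff left_diff_distrib distrib_right cos_add cos_diff sin_add sin_diff
    by (simp add: field_simps)
  ultimately show ?thesis by (simp only:)
qed

lemma has_integral_cos_cos:
  fixes b m :: int
  assumes "m > 0" "b \<ge> 0"
  shows "((\<lambda>z. cos (of_int b * z) * cos (of_int m * z)) has_integral
    pi / 2 * of_bool (b = m)) {0..pi}"
  using has_integral_cos_cos_cos[of m 0 b] assms by (simp add: of_bool_def split: if_splits)

text \<open>Fubini on the rectangle. The constant vector \<open>c\<close> lets one statement serve
  scalar and velocity valued brackets.\<close>

lemma bracket_separable:
  fixes f g :: "real \<Rightarrow> real" and c :: "'b::banach"
  assumes "k > 0" "(f has_integral F) {0..2 * pi / k}" "(g has_integral G) {0..pi}"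
    and "continuous_on UNIV f" "continuous_on UNIV g"
  shows "bracket k (\<lambda>(x, z). (f x * g z) *\<^sub>R c) = (F * G) *\<^sub>R c"
proof -
  have *: "Omega k = cbox (0, 0) (2 * pi / k, pi)" by (simp add: Omega_def cbox_Pair_eq)
  have g: "((\<lambda>z. (f x * g z) *\<^sub>R c) has_integral (f x * G) *\<^sub>R c) (cbox 0 pi)" for x
    using assms(3) by (intro has_integral_scaleR_left has_integral_mult_right) auto
  have f: "((\<lambda>x. (f x * G) *\<^sub>R c) has_integral (F * G) *\<^sub>R c) (cbox 0 (2 * pi / k))"
    using assms(2) by (intro has_integral_scaleR_left has_integral_mult_left) auto
  have "continuous_on UNIV (\<lambda>(x, z). (f x * g z) *\<^sub>R c)"
    unfolding case_prod_unfold
    by (intro continuous_intros continuous_on_compose2[OF assms(4)] continuous_on_compose2[OF assms(5)]) auto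
  then have "continuous_on (cbox (0, 0) (2 * pi / k, pi)) (\<lambda>(x, z). (f x * g z) *\<^sub>R c)"
    by (rule continuous_on_subset) simp
  from integral_prod_continuous[OF this] show ?thesis
    unfolding bracket_def * using integral_unique[OF g] integral_unique[OF f] by simp
qed

section \<open>Modes and their horizontal profiles\<close>

definition wave1 :: "mode \<Rightarrow> int" where "wave1 n = fst n"
definition wave3 :: "mode \<Rightarrow> int" where "wave3 n = fst (snd n)"
definition phase :: "mode \<Rightarrow> int" where "phase n = fst (snd (snd n))"
definition mode_comp :: "mode \<Rightarrow> int" where "mode_comp n = snd (snd (snd n))"

lemmas mode_sel_defs = wave1_def wave3_def phase_def mode_comp_def

lemma mode_sel [simp]:
  "wave1 (m1, m3, p, c) = m1" "wave3 (m1, m3, p, c) = m3" "phase (m1, m3, p, c) = p" "mode_comp (m1, m3, p, c) = c"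
  by (simp_all add: mode_sel_defs)

lemma NuD:
  assumes "n \<in> Nu"
  shows "wave1 n \<ge> 0" "wave3 n \<ge> 0" "phase n = 1 \<or> phase n = 2" "mode_comp n = 1 \<or> mode_comp n = 2"
    "wave1 n = 0 \<Longrightarrow> phase n = 2" "wave3 n = 0 \<Longrightarrow> mode_comp n = 2" "wave1 n = 0 \<Longrightarrow> wave3 n > 0"
  using assms by (cases n; force simp: Nu_def split: if_splits)+

definition kappa :: "real \<Rightarrow> mode \<Rightarrow> real" where "kappa k n = k * of_int (wave1 n)"

text \<open>
  The two \<open>x\<^sub>1\<close>-profiles of a mode satisfy \<open>X' = \<kappa> Y\<close> and \<open>Y' = - \<kappa> X\<close> for both phases, which
  avoids case distinctions on phases. The stream function is proportional to \<open>X sin (m\<^sub>3 x\<^sub>3)\<close>.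
\<close>

definition Xf :: "real \<Rightarrow> mode \<Rightarrow> real \<Rightarrow> real" where
  "Xf k n x = (if phase n = 1 then sin (kappa k n * x) else cos (kappa k n * x))"
definition Yf :: "real \<Rightarrow> mode \<Rightarrow> real \<Rightarrow> real" where
  "Yf k n x = (if phase n = 1 then cos (kappa k n * x) else - sin (kappa k n * x))"

lemma Xf_deriv: "(Xf k n has_real_derivative kappa k n * Yf k n x) (at x within A)"
proof (cases "phase n = 1")
  case True
  then have "Xf k n = (\<lambda>x. sin (kappa k n * x))" "Yf k n x = cos (kappa k n * x)"
    by (auto simp: Xf_def Yf_def)
  then show ?thesis by (auto intro!: derivative_eq_intros)
next
  case False
  then have "Xf k n = (\<lambda>x. cos (kappa k n * x))" "Yf k n x = - sin (kappa k n * x)"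
    by (auto simp: Xf_def Yf_def)
  then show ?thesis by (auto intro!: derivative_eq_intros)
qed

lemma Yf_deriv: "(Yf k n has_real_derivative - (kappa k n * Xf k n x)) (at x within A)"
proof (cases "phase n = 1")
  case True
  then have "Yf k n = (\<lambda>x. cos (kappa k n * x))" "Xf k n x = sin (kappa k n * x)"
    by (auto simp: Xf_def Yf_def)
  then show ?thesis by (auto intro!: derivative_eq_intros)
next
  case False
  then have "Yf k n = (\<lambda>x. - sin (kappa k n * x))" "Xf k n x = cos (kappa k n * x)"
    by (auto simp: Xf_def Yf_def)
  then show ?thesis by (auto intro!: derivative_eq_intros)
qed

lemma continuous_on_Xf [continuous_intros]: "continuous_on A f \<Longrightarrow> continuous_on A (\<lambda>x. Xf k n (f x))"
  by (rule continuous_on_compose2[where t = UNIV and g = "Xf k n"])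
     (auto intro: DERIV_continuous_on[OF Xf_deriv])

lemma continuous_on_Yf [continuous_intros]: "continuous_on A f \<Longrightarrow> continuous_on A (\<lambda>x. Yf k n (f x))"
  by (rule continuous_on_compose2[where t = UNIV and g = "Yf k n"])
     (auto intro: DERIV_continuous_on[OF Yf_deriv])

lemma XYf_period:
  assumes "k > 0" shows "Xf k n (2 * pi / k) = Xf k n 0" "Yf k n (2 * pi / k) = Yf k n 0"
  using sin_int_period[OF assms, of "wave1 n"] cos_int_period[OF assms, of "wave1 n"]
  unfolding Xf_def Yf_def kappa_def by auto

text \<open>Within \<open>Nu\<close> a vanishing horizontal wave number forces phase 2, so that
  \<open>Xf\<close> is then the constant 1. In all other cases it is a sine or cosine over full
  periods.\<close>

lemma has_integral_Xf:
  assumes "k > 0" "n \<in> Nu"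
  shows "(Xf k n has_integral (if wave1 n = 0 then 2 * pi / k else 0)) {0..2 * pi / k}"
  using has_integral_cos_period[OF assms(1), of "wave1 n"] has_integral_sin_period[OF assms(1), of "wave1 n"]
    NuD[OF assms(2)]
  unfolding Xf_def[abs_def] kappa_def by (auto split: if_splits)

lemma has_integral_Yf:
  assumes "k > 0" "n \<in> Nu"
  shows "(Yf k n has_integral 0) {0..2 * pi / k}"
  using has_integral_cos_period[OF assms(1), of "wave1 n"]
    has_integral_neg[OF has_integral_sin_period[OF assms(1), of "wave1 n"]] NuD[OF assms(2)]
  unfolding Yf_def[abs_def] kappa_def by (auto split: if_splits)

text \<open>The integral of \<open>X\<^sub>i X\<^sub>j'\<close> over a period; it is antisymmetric.\<close>

definition coupling :: "mode \<Rightarrow> mode \<Rightarrow> real" where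
  "coupling i j = (if wave1 i = wave1 j \<and> phase i \<noteq> phase j
     then (if phase i = 1 then - pi * of_int (wave1 i) else pi * of_int (wave1 i)) else 0)"

lemma coupling_sym:
  assumes "i \<in> Nu" "j \<in> Nu" shows "coupling j i = - coupling i j"
  using NuD[OF assms(1)] NuD[OF assms(2)] by (auto simp: coupling_def)

lemma has_integral_Xf_Yf:
  assumes k: "k > 0" and "i \<in> Nu" "j \<in> Nu"
  shows "((\<lambda>x. Xf k i x * (kappa k j * Yf k j x)) has_integral coupling i j) {0..2 * pi / k}"
proof -
  define a b where "a = wave1 i" and "b = wave1 j"
  have ab: "a \<ge> 0" "b \<ge> 0" using NuD assms by (auto simp: a_def b_def)
  note C = has_integral_cos_period[OF k] and S = has_integral_sin_period[OF k]
  have s: "k * real_of_int (a + b) * x = k * a * x + k * b * x"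
      "k * real_of_int (a - b) * x = k * a * x - k * b * x" for x
    by (simp_all add: algebra_simps)
  have ss: "((\<lambda>x. sin (k * a * x) * sin (k * b * x)) has_integral
      ((if a - b = 0 then 2 * pi / k else 0) - (if a + b = 0 then 2 * pi / k else 0)) / 2) {0..2 * pi / k}"
    unfolding sin_times_sin s[symmetric] by (intro has_integral_divide has_integral_diff C)
  have cc: "((\<lambda>x. cos (k * a * x) * cos (k * b * x)) has_integral
      ((if a - b = 0 then 2 * pi / k else 0) + (if a + b = 0 then 2 * pi / k else 0)) / 2) {0..2 * pi / k}"
    unfolding cos_times_cos s[symmetric] by (intro has_integral_divide has_integral_add C)
  have sc: "((\<lambda>x. sin (k * a * x) * cos (k * b * x)) has_integral (0 + 0) / 2) {0..2 * pi / k}"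
    unfolding sin_times_cos s[symmetric] by (intro has_integral_divide has_integral_add S)
  have cs: "((\<lambda>x. cos (k * a * x) * sin (k * b * x)) has_integral (0 - 0) / 2) {0..2 * pi / k}"
    unfolding cos_times_sin s[symmetric] by (intro has_integral_divide has_integral_diff S)
  \<comment> \<open>The extra term 2 pi / k of the product-to-sum formula appears only when both
    wave numbers vanish, and there the prefactor k * b removes it.\<close>
  have ap: "a = 0 \<and> b = 0" if "a + b = 0" using that ab by auto
  consider "phase i = 1" "phase j = 1" | "phase i = 1" "phase j = 2"
    | "phase i = 2" "phase j = 1" | "phase i = 2" "phase j = 2"
    using NuD(3) assms by blast
  then show ?thesis
  proof cases
    case 1
    then have "Xf k i x * (kappa k j * Yf k j x) = k * b * (sin (k * a * x) * cos (k * b * x))" for x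
      by (simp add: Xf_def Yf_def kappa_def a_def b_def)
    with has_integral_mult_right[OF sc, of "k * b"] 1 show ?thesis
      by (simp add: coupling_def)
  next
    case 2
    then have "Xf k i x * (kappa k j * Yf k j x) = - (k * b) * (sin (k * a * x) * sin (k * b * x))" for x
      by (simp add: Xf_def Yf_def kappa_def a_def b_def)
    moreover have "- (k * b) * (((if a - b = 0 then 2 * pi / k else 0)
        - (if a + b = 0 then 2 * pi / k else 0)) / 2) = coupling i j"
      using 2 k ap ab by (cases "a + b = 0") (auto simp: coupling_def simp flip: a_def b_def)
    ultimately show ?thesis
      using has_integral_mult_right[OF ss, of "- (k * b)"] by (simp only:)
  next
    case 3
    then have "Xf k i x * (kappa k j * Yf k j x) = k * b * (cos (k * a * x) * cos (k * b * x))" for x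
      by (simp add: Xf_def Yf_def kappa_def a_def b_def)
    moreover have "k * b * (((if a - b = 0 then 2 * pi / k else 0)
        + (if a + b = 0 then 2 * pi / k else 0)) / 2) = coupling i j"
      using 3 k ap ab by (cases "a + b = 0") (auto simp: coupling_def simp flip: a_def b_def)
    ultimately show ?thesis
      using has_integral_mult_right[OF cc, of "k * b"] by (simp only:)
  next
    case 4
    then have "Xf k i x * (kappa k j * Yf k j x) = - (k * b) * (cos (k * a * x) * sin (k * b * x))" for x
      by (simp add: Xf_def Yf_def kappa_def a_def b_def)
    with has_integral_mult_right[OF cs, of "- (k * b)"] 4 show ?thesis
      by (simp add: coupling_def)
  qed
qed

section \<open>Trigonometric fields on the domain\<close>

lemma integrable_Omega:
  fixes f :: "'b::banach field"
  assumes "continuous_on UNIV f" shows "f integrable_on Omega k"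
proof -
  have "Omega k = cbox (0, 0) (2 * pi / k, pi)" by (simp add: Omega_def cbox_Pair_eq)
  then show ?thesis using assms by (auto intro!: integrable_continuous intro: continuous_on_subset)
qed

lemma bracket_add:
  assumes "continuous_on UNIV f" "continuous_on UNIV g"
  shows "bracket k (\<lambda>x. f x + g x) = bracket k f + bracket k g"
  unfolding bracket_def by (intro integral_add integrable_Omega assms)

lemma bracket_scaleR: "bracket k (\<lambda>x. c *\<^sub>R f x) = c *\<^sub>R bracket k f"
  unfolding bracket_def by (rule integral_cmul)

lemma bracket_cmult: "bracket k (\<lambda>x. c * f x :: real) = c * bracket k f"
  using bracket_scaleR[of k c f] by simp

lemma bracket_sum:
  assumes "finite N" "\<And>n. n \<in> N \<Longrightarrow> continuous_on UNIV (f n)"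
  shows "bracket k (\<lambda>x. \<Sum>n\<in>N. f n x) = (\<Sum>n\<in>N. bracket k (f n))"
  unfolding bracket_def using assms by (intro integral_sum integrable_Omega) auto

text \<open>For a fixed mode these fields form a space closed under both partial derivatives, which
  merely permute and scale the four coefficients. Laplacian, curl and brackets of expansions thereby
  become algebra on coefficients.\<close>

definition trig :: "real \<Rightarrow> mode \<Rightarrow> 'b::real_normed_vector \<Rightarrow> 'b \<Rightarrow> 'b \<Rightarrow> 'b \<Rightarrow> 'b field" where
  "trig k n A B C D = (\<lambda>(x, z).
     (Xf k n x * cos (of_int (wave3 n) * z)) *\<^sub>R A + (Xf k n x * sin (of_int (wave3 n) * z)) *\<^sub>R B +
     (Yf k n x * cos (of_int (wave3 n) * z)) *\<^sub>R C + (Yf k n x * sin (of_int (wave3 n) * z)) *\<^sub>R D)"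

definition trig_sum where
  "trig_sum k N A B C D = (\<lambda>x. \<Sum>n\<in>N. trig k n (A n) (B n) (C n) (D n) x)"

lemma continuous_on_trig [continuous_intros]: "continuous_on S (trig k n A B C D)"
  unfolding trig_def case_prod_unfold by (intro continuous_intros)

lemma trig_has_d1:
  "((\<lambda>s. trig k n A B C D (s, z)) has_vector_derivative
     trig k n (- kappa k n *\<^sub>R C) (- kappa k n *\<^sub>R D) (kappa k n *\<^sub>R A) (kappa k n *\<^sub>R B) (x, z)) (at x)"
  unfolding trig_def split
  by (rule has_vector_derivative_eq_rhs,
      (rule has_vector_derivative_add has_vector_derivative_scaleR has_vector_derivative_const
         DERIV_cmult_right Xf_deriv Yf_deriv)+) (simp add: algebra_simps)

lemma trig_has_d3:
  "((\<lambda>s. trig k n A B C D (x, s)) has_vector_derivative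
     trig k n (of_int (wave3 n) *\<^sub>R B) (- of_int (wave3 n) *\<^sub>R A)
       (of_int (wave3 n) *\<^sub>R D) (- of_int (wave3 n) *\<^sub>R C) (x, z)) (at z)"
proof -
  have s: "((\<lambda>s. sin (of_int (wave3 n) * s)) has_real_derivative
      of_int (wave3 n) * cos (of_int (wave3 n) * z)) (at z)"
    and c: "((\<lambda>s. cos (of_int (wave3 n) * s)) has_real_derivative
      - of_int (wave3 n) * sin (of_int (wave3 n) * z)) (at z)"
    by (auto intro!: derivative_eq_intros)
  show ?thesis
    unfolding trig_def split
    by (rule has_vector_derivative_eq_rhs,
        (rule has_vector_derivative_add has_vector_derivative_scaleR has_vector_derivative_const
           DERIV_cmult s c)+) (simp add: algebra_simps)
qed

lemma d1_trig_sum: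
  "d1 (trig_sum k N A B C D) = trig_sum k N (\<lambda>n. - kappa k n *\<^sub>R C n) (\<lambda>n. - kappa k n *\<^sub>R D n)
     (\<lambda>n. kappa k n *\<^sub>R A n) (\<lambda>n. kappa k n *\<^sub>R B n)"
  unfolding d1_def trig_sum_def
  by (intro ext, clarify) (intro vector_derivative_at has_vector_derivative_sum trig_has_d1)

lemma d3_trig_sum:
  "d3 (trig_sum k N A B C D) = trig_sum k N (\<lambda>n. of_int (wave3 n) *\<^sub>R B n) (\<lambda>n. - of_int (wave3 n) *\<^sub>R A n)
     (\<lambda>n. of_int (wave3 n) *\<^sub>R D n) (\<lambda>n. - of_int (wave3 n) *\<^sub>R C n)"
  unfolding d3_def trig_sum_def
  by (intro ext, clarify) (intro vector_derivative_at has_vector_derivative_sum trig_has_d3)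

lemma trig_linear:
  assumes "linear L" shows "L (trig k n A B C D x) = trig k n (L A) (L B) (L C) (L D) x"
  unfolding trig_def case_prod_unfold by (simp only: linear_add[OF assms] linear_scale[OF assms])

lemma trig_sum_linear:
  assumes "linear L"
  shows "L (trig_sum k N A B C D x) =
    trig_sum k N (\<lambda>n. L (A n)) (\<lambda>n. L (B n)) (\<lambda>n. L (C n)) (\<lambda>n. L (D n)) x"
  unfolding trig_sum_def by (simp only: linear_sum[OF assms] trig_linear[OF assms])

lemma trig_sum_add:
  "trig_sum k N A B C D x + trig_sum k N A' B' C' D' x =
    trig_sum k N (\<lambda>n. A n + A' n) (\<lambda>n. B n + B' n) (\<lambda>n. C n + C' n) (\<lambda>n. D n + D' n) x"
  unfolding trig_sum_def trig_def case_prod_unfold sum.distrib[symmetric]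
  by (intro sum.cong) (simp_all add: algebra_simps)

text \<open>The only modes that contribute to the mean vorticity and to \<open>\<langle>\<partial>\<^sub>3 u\<rangle>\<close>.\<close>

definition odd_mean :: "mode \<Rightarrow> bool" where "odd_mean n \<longleftrightarrow> wave1 n = 0 \<and> odd (wave3 n)"

text \<open>The Y-terms have mean zero over a period, and so do the X-terms unless the mode is mean.
  Its vertical wave number m is then positive, so the cosine integrates to 0 and the sine to 2 / m
  for odd m and to 0 for even m. The constant is (2 pi / k) (2 / m).\<close>

lemma bracket_trig:
  fixes A B C D :: "'b::banach"
  assumes k: "k > 0" and n: "n \<in> Nu"
  shows "bracket k (trig k n A B C D) =
    (if odd_mean n then (4 * pi / (k * of_int (wave3 n))) *\<^sub>R B else 0)"
proof -
  let ?m = "of_int (wave3 n) :: real"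
  have c: "continuous_on UNIV (Xf k n)" "continuous_on UNIV (Yf k n)"
    "continuous_on UNIV (\<lambda>z. cos (?m * z))" "continuous_on UNIV (\<lambda>z. sin (?m * z))"
    using continuous_on_Xf[OF continuous_on_id] continuous_on_Yf[OF continuous_on_id]
    by (auto intro!: continuous_intros simp: id_def)
  note b = bracket_separable[OF k has_integral_Xf[OF k n] has_integral_cos_int c(1,3)]
    bracket_separable[OF k has_integral_Xf[OF k n] has_integral_sin_int c(1,4)]
    bracket_separable[OF k has_integral_Yf[OF k n] has_integral_cos_int c(2,3)]
    bracket_separable[OF k has_integral_Yf[OF k n] has_integral_sin_int c(2,4)]
  have "bracket k (trig k n A B C D) =
     bracket k (\<lambda>(x, z). (Xf k n x * cos (?m * z)) *\<^sub>R A) + bracket k (\<lambda>(x, z). (Xf k n x * sin (?m * z)) *\<^sub>R B) +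
     bracket k (\<lambda>(x, z). (Yf k n x * cos (?m * z)) *\<^sub>R C) + bracket k (\<lambda>(x, z). (Yf k n x * sin (?m * z)) *\<^sub>R D)"
    unfolding trig_def case_prod_unfold
    by (subst bracket_add[symmetric]; (intro continuous_intros)?)+ simp
  also have "\<dots> = (if odd_mean n then (4 * pi / (k * ?m)) *\<^sub>R B else 0)"
    unfolding b using NuD(7)[OF n] by (auto simp: odd_mean_def)
  finally show ?thesis .
qed

lemma bracket_trig_sum:
  fixes A B C D :: "mode \<Rightarrow> 'b::banach"
  assumes "k > 0" "finite N" "N \<subseteq> Nu"
  shows "bracket k (trig_sum k N A B C D) =
    (\<Sum>n\<in>{n\<in>N. odd_mean n}. (4 * pi / (k * of_int (wave3 n))) *\<^sub>R B n)"
proof -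
  have "bracket k (trig_sum k N A B C D) = (\<Sum>n\<in>N. bracket k (trig k n (A n) (B n) (C n) (D n)))"
    unfolding trig_sum_def using assms by (intro bracket_sum continuous_intros)
  also have "\<dots> = (\<Sum>n\<in>N. if odd_mean n then (4 * pi / (k * of_int (wave3 n))) *\<^sub>R B n else 0)"
    using assms by (intro sum.cong) (auto simp: bracket_trig)
  finally show ?thesis using assms by (simp add: sum.inter_filter)
qed

section \<open>Basis functions and expansions as trigonometric fields\<close>

definition stream_amp :: "real \<Rightarrow> mode \<Rightarrow> real" where
  "stream_amp k n = (if mode_comp n = 1 then eta (wave1 n) (wave3 n) / (Knorm k (wave1 n) (wave3 n) * Vnorm k) else 0)"
definition swirl_amp :: "real \<Rightarrow> mode \<Rightarrow> real" where
  "swirl_amp k n = (if mode_comp n = 1 then 0 else eta (wave1 n) (wave3 n) / Vnorm k)"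
text \<open>\<open>cos_dir\<close> and \<open>sin_dir\<close> are the vector coefficients of the X
  cos and Y sin terms of a velocity mode. One of the two amplitudes is always zero, so formulas
  containing both cover the two components without a case split.\<close>

definition cos_dir :: "real \<Rightarrow> mode \<Rightarrow> real^3" where
  "cos_dir k n = vector [stream_amp k n * of_int (wave3 n), swirl_amp k n, 0]"
definition sin_dir :: "real \<Rightarrow> mode \<Rightarrow> real^3" where
  "sin_dir k n = vector [0, 0, - (stream_amp k n * kappa k n)]"
text \<open>The sign compensates \<open>Yf\<close>, which is minus the sine for phase 2.\<close>

definition temp_amp :: "real \<Rightarrow> mode \<Rightarrow> real" where
  "temp_amp k n = (if phase n = 1 then 1 else - 1) * (eta (wave1 n) (wave3 n) / Vnorm k)"

lemma vbasis_trig: "vbasis k n = trig k n (cos_dir k n) 0 0 (sin_dir k n)"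
proof (cases n)
  case (fields m1 m3 p c)
  then show ?thesis
    by (auto simp: fun_eq_iff trig_def cos_dir_def sin_dir_def stream_amp_def swirl_amp_def Xf_def Yf_def kappa_def vec_eq_iff forall_3 axis_def)
qed

lemma fbasis_trig: "fbasis k n = trig k n 0 0 0 (temp_amp k n)"
proof (cases n)
  case (fields m1 m3 p c)
  then show ?thesis
    by (auto simp: fun_eq_iff trig_def temp_amp_def Yf_def kappa_def)
qed

lemma trig_scaleR: "a *\<^sub>R trig k n A B C D x = trig k n (a *\<^sub>R A) (a *\<^sub>R B) (a *\<^sub>R C) (a *\<^sub>R D) x"
  by (rule trig_linear) (intro linear_scale_self)

lemma vexpand_trig: "vexpand k N a = trig_sum k N (\<lambda>n. a n *\<^sub>R cos_dir k n) (\<lambda>n. 0) (\<lambda>n. 0) (\<lambda>n. a n *\<^sub>R sin_dir k n)"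
  unfolding vexpand_def trig_sum_def vbasis_trig trig_scaleR by simp

lemma fexpand_trig: "fexpand k N b = trig_sum k N (\<lambda>n. 0) (\<lambda>n. 0) (\<lambda>n. 0) (\<lambda>n. b n * temp_amp k n)"
  unfolding fexpand_def trig_sum_def fbasis_trig real_scaleR_def[symmetric] trig_scaleR by simp

lemma laplacian_vexpand:
  "laplacian (vexpand k N a) = vexpand k N (\<lambda>n. - ((kappa k n)\<^sup>2 + (of_int (wave3 n))\<^sup>2) * a n)"
  unfolding laplacian_def vexpand_trig d1_trig_sum d3_trig_sum trig_sum_add
  by (simp add: power2_eq_square algebra_simps scaleR_left_distrib[symmetric])

lemma laplacian_fexpand:
  "laplacian (fexpand k N a) = fexpand k N (\<lambda>n. - ((kappa k n)\<^sup>2 + (of_int (wave3 n))\<^sup>2) * a n)"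
  unfolding laplacian_def fexpand_trig d1_trig_sum d3_trig_sum trig_sum_add
  by (simp add: power2_eq_square algebra_simps)

text \<open>The curl is \<open>curl1 (\<partial>\<^sub>1 u) + curl3 (\<partial>\<^sub>3 u)\<close>; moreover \<open>curl3 u\<close> is the Coriolis term \<open>e3 \<times> u\<close>.\<close>

definition curl1 :: "real^3 \<Rightarrow> real^3" where "curl1 w = vector [0, - w $ 3, w $ 2]"
definition curl3 :: "real^3 \<Rightarrow> real^3" where "curl3 w = vector [- w $ 2, w $ 1, 0]"

lemma linear_curl1: "linear curl1" and linear_curl3: "linear curl3"
  by (intro linearI; simp add: curl1_def curl3_def vec_eq_iff forall_3)+

lemma curl_eq: "curl u x = curl1 (d1 u x) + curl3 (d3 u x)"
  by (simp add: curl_def curl1_def curl3_def vec_eq_iff forall_3)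

lemma curl_trig_sum:
  "curl (trig_sum k N A B C D) = trig_sum k N
     (\<lambda>n. curl1 (- kappa k n *\<^sub>R C n) + curl3 (of_int (wave3 n) *\<^sub>R B n))
     (\<lambda>n. curl1 (- kappa k n *\<^sub>R D n) + curl3 (- of_int (wave3 n) *\<^sub>R A n))
     (\<lambda>n. curl1 (kappa k n *\<^sub>R A n) + curl3 (of_int (wave3 n) *\<^sub>R D n))
     (\<lambda>n. curl1 (kappa k n *\<^sub>R B n) + curl3 (- of_int (wave3 n) *\<^sub>R C n))"
  unfolding fun_eq_iff curl_eq
  by (simp only: d1_trig_sum d3_trig_sum trig_sum_linear[OF linear_curl1] trig_sum_linear[OF linear_curl3]
      trig_sum_add) simp

context
  fixes k :: real and N :: "mode set"
  assumes k: "k > 0" and N: "finite N" "N \<subseteq> Nu"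
begin

text \<open>On a mean mode the curl is \<open>curl3\<close> applied to the vertical derivative. The
  derivative brings down the vertical wave number, which cancels the one in the denominator of
  \<open>bracket_trig_sum\<close> and leaves the same factor for all modes.\<close>

lemma bracket_curl_vexpand:
  "bracket k (curl (vexpand k N a)) = - (4 * pi / k) *\<^sub>R (\<Sum>n\<in>{n\<in>N. odd_mean n}. a n *\<^sub>R curl3 (cos_dir k n))"
  unfolding vexpand_trig curl_trig_sum bracket_trig_sum[OF k N] scaleR_sum_right
proof (intro sum.cong refl)
  fix n assume "n \<in> {n \<in> N. odd_mean n}"
  then have "kappa k n = 0" "wave3 n \<noteq> 0" by (auto simp: odd_mean_def kappa_def)
  then show "(4 * pi / (k * of_int (wave3 n))) *\<^sub>R
      (curl1 (- kappa k n *\<^sub>R a n *\<^sub>R sin_dir k n) + curl3 (- of_int (wave3 n) *\<^sub>R a n *\<^sub>R cos_dir k n)) =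
      - (4 * pi / k) *\<^sub>R a n *\<^sub>R curl3 (cos_dir k n)"
    by (simp add: linear_scale[OF linear_curl3] linear_0[OF linear_curl1] linear_neg[OF linear_curl3])
qed

lemma bracket_d3_d3_curl_vexpand:
  "bracket k (d3 (d3 (curl (vexpand k N a)))) =
    - (4 * pi / k) *\<^sub>R (\<Sum>n\<in>{n\<in>N. odd_mean n}. (- (of_int (wave3 n))\<^sup>2 * a n) *\<^sub>R curl3 (cos_dir k n))"
  unfolding vexpand_trig curl_trig_sum d3_trig_sum bracket_trig_sum[OF k N] scaleR_sum_right
proof (intro sum.cong refl)
  fix n assume "n \<in> {n \<in> N. odd_mean n}"
  then have "kappa k n = 0" "wave3 n \<noteq> 0" by (auto simp: odd_mean_def kappa_def)
  then show "(4 * pi / (k * of_int (wave3 n))) *\<^sub>R - of_int (wave3 n) *\<^sub>R of_int (wave3 n) *\<^sub>R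
      (curl1 (- kappa k n *\<^sub>R a n *\<^sub>R sin_dir k n) + curl3 (- of_int (wave3 n) *\<^sub>R a n *\<^sub>R cos_dir k n)) =
      - (4 * pi / k) *\<^sub>R (- (of_int (wave3 n))\<^sup>2 * a n) *\<^sub>R curl3 (cos_dir k n)"
    by (simp add: linear_scale[OF linear_curl3] linear_0[OF linear_curl1] linear_neg[OF linear_curl3] power2_eq_square)
qed

lemma bracket_d3_vexpand:
  "bracket k (d3 (vexpand k N a)) = - (4 * pi / k) *\<^sub>R (\<Sum>n\<in>{n\<in>N. odd_mean n}. a n *\<^sub>R cos_dir k n)"
  unfolding vexpand_trig d3_trig_sum bracket_trig_sum[OF k N] scaleR_sum_right
  by (intro sum.cong refl) (auto simp: odd_mean_def)

end

section \<open>The truncated model in coefficients\<close>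

lemma d1_trig: "d1 (trig k n A B C D) =
    trig k n (- kappa k n *\<^sub>R C) (- kappa k n *\<^sub>R D) (kappa k n *\<^sub>R A) (kappa k n *\<^sub>R B)"
  unfolding d1_def by (intro ext, clarify) (intro vector_derivative_at trig_has_d1)

lemma d3_trig: "d3 (trig k n A B C D) =
    trig k n (of_int (wave3 n) *\<^sub>R B) (- of_int (wave3 n) *\<^sub>R A)
      (of_int (wave3 n) *\<^sub>R D) (- of_int (wave3 n) *\<^sub>R C)"
  unfolding d3_def by (intro ext, clarify) (intro vector_derivative_at trig_has_d3)

lemma d1_trig_combination:
  "d1 (\<lambda>x. \<Sum>n\<in>N. a n *\<^sub>R trig k n (A n) (B n) (C n) (D n) x) x
     = (\<Sum>n\<in>N. a n *\<^sub>R d1 (trig k n (A n) (B n) (C n) (D n)) x)"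
  using fun_cong[OF d1_trig_sum[of k N "\<lambda>n. a n *\<^sub>R A n" "\<lambda>n. a n *\<^sub>R B n" "\<lambda>n. a n *\<^sub>R C n" "\<lambda>n. a n *\<^sub>R D n"], of x]
  unfolding trig_sum_def d1_trig trig_scaleR by (simp add: mult.commute)

lemma d3_trig_combination:
  "d3 (\<lambda>x. \<Sum>n\<in>N. a n *\<^sub>R trig k n (A n) (B n) (C n) (D n) x) x
     = (\<Sum>n\<in>N. a n *\<^sub>R d3 (trig k n (A n) (B n) (C n) (D n)) x)"
  using fun_cong[OF d3_trig_sum[of k N "\<lambda>n. a n *\<^sub>R A n" "\<lambda>n. a n *\<^sub>R B n" "\<lambda>n. a n *\<^sub>R C n" "\<lambda>n. a n *\<^sub>R D n"], of x]
  unfolding trig_sum_def d3_trig trig_scaleR by (simp add: mult.commute)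

lemma d1_vexpand: "d1 (vexpand k N a) x = (\<Sum>n\<in>N. a n *\<^sub>R d1 (vbasis k n) x)"
  and d3_vexpand: "d3 (vexpand k N a) x = (\<Sum>n\<in>N. a n *\<^sub>R d3 (vbasis k n) x)"
  unfolding vexpand_def vbasis_trig by (rule d1_trig_combination d3_trig_combination)+

lemma d1_fexpand: "d1 (fexpand k N a) x = (\<Sum>n\<in>N. a n *\<^sub>R d1 (fbasis k n) x)"
  and d3_fexpand: "d3 (fexpand k N a) x = (\<Sum>n\<in>N. a n *\<^sub>R d3 (fbasis k n) x)"
  unfolding fexpand_def fbasis_trig real_scaleR_def[symmetric]
  by (rule d1_trig_combination d3_trig_combination)+

lemma curl_vexpand: "curl (vexpand k N a) x = (\<Sum>n\<in>N. a n *\<^sub>R curl (vbasis k n) x)"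
  unfolding curl_eq d1_vexpand d3_vexpand linear_sum[OF linear_curl1] linear_sum[OF linear_curl3]
    linear_scale[OF linear_curl1] linear_scale[OF linear_curl3] scaleR_add_right sum.distrib ..

lemma advect_sum_left:
  assumes "\<And>x. w x = (\<Sum>i\<in>N. a i *\<^sub>R wi i x)"
  shows "advect w f x = (\<Sum>i\<in>N. a i *\<^sub>R advect (wi i) f x)"
  unfolding advect_def assms sum_component vector_scaleR_component
  by (simp add: scaleR_sum_left scaleR_add_right sum.distrib)

lemma advect_vexpand: "advect w (vexpand k N a) x = (\<Sum>i\<in>N. a i *\<^sub>R advect w (vbasis k i) x)"
  unfolding advect_def d1_vexpand d3_vexpand
  by (simp add: scaleR_sum_right scaleR_add_right sum.distrib mult.commute)

lemma advect_fexpand: "advect w (fexpand k N a) x = (\<Sum>i\<in>N. a i *\<^sub>R advect w (fbasis k i) x)"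
  unfolding advect_def d1_fexpand d3_fexpand
  by (simp add: sum_distrib_left distrib_left sum.distrib mult_ac)

lemma advect_vexpand_vexpand:
  "advect (vexpand k N a) (vexpand k M b) x = (\<Sum>i\<in>N. \<Sum>j\<in>M. (a i * b j) *\<^sub>R advect (vbasis k i) (vbasis k j) x)"
  by (simp add: advect_sum_left[OF vexpand_def[THEN fun_cong, simplified]] advect_vexpand scaleR_sum_right)

lemma advect_vexpand_fexpand:
  "advect (vexpand k N a) (fexpand k M b) x = (\<Sum>i\<in>N. \<Sum>j\<in>M. a i * b j * advect (vbasis k i) (fbasis k j) x)"
  by (simp add: advect_sum_left[OF vexpand_def[THEN fun_cong, simplified]] advect_fexpand sum_distrib_left mult_ac)

lemma advect_curl_vexpand_vexpand:
  "advect (curl (vexpand k N a)) (vexpand k M b) x =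
     (\<Sum>j\<in>N. \<Sum>i\<in>M. (a j * b i) *\<^sub>R advect (curl (vbasis k j)) (vbasis k i) x)"
  by (simp add: advect_sum_left[OF curl_vexpand] advect_vexpand scaleR_sum_right)

lemma continuous_on_vbasis [continuous_intros]: "continuous_on S (vbasis k n)"
  "continuous_on S (d1 (vbasis k n))" "continuous_on S (d3 (vbasis k n))"
  unfolding vbasis_trig d1_trig d3_trig by (intro continuous_intros)+

lemma continuous_on_fbasis [continuous_intros]: "continuous_on S (fbasis k n)"
  "continuous_on S (d1 (fbasis k n))" "continuous_on S (d3 (fbasis k n))"
  unfolding fbasis_trig d1_trig d3_trig by (intro continuous_intros)+

lemma continuous_on_advect [continuous_intros]:
  assumes "continuous_on S w" "continuous_on S (d1 f)" "continuous_on S (d3 f)"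
  shows "continuous_on S (advect w f)"
  unfolding advect_def using assms by (intro continuous_intros)

lemma continuous_on_curl [continuous_intros]:
  assumes "continuous_on S (d1 f)" "continuous_on S (d3 f)"
  shows "continuous_on S (curl f)"
proof -
  have L: "bounded_linear curl1" "bounded_linear curl3"
    using linear_curl1 linear_curl3 by (simp_all add: linear_conv_bounded_linear)
  show ?thesis unfolding curl_eq[abs_def]
    using bounded_linear.continuous_on[OF L(1) assms(1)] bounded_linear.continuous_on[OF L(2) assms(2)]
    by (rule continuous_on_add)
qed

section \<open>Interaction coefficients of the Galerkin system\<close>

definition quad_u where
  "quad_u k i j n = bracket k (\<lambda>x. advect (vbasis k i) (vbasis k j) x \<bullet> vbasis k n x)"
definition rot_u where
  "rot_u k j n = bracket k (\<lambda>x. cross3 e3 (vbasis k j x) \<bullet> vbasis k n x)"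
definition buoy_u where
  "buoy_u k j n = bracket k (\<lambda>x. (fbasis k j x *\<^sub>R e3) \<bullet> vbasis k n x)"
definition quad_th where
  "quad_th k i j n = bracket k (\<lambda>x. advect (vbasis k i) (fbasis k j) x * fbasis k n x)"
definition lift_th where
  "lift_th k j n = bracket k (\<lambda>x. vbasis k j x $ 3 * fbasis k n x)"

definition coeff_u where
  "coeff_u R S P k N M a b n = - P * ((kappa k n)\<^sup>2 + (of_int (wave3 n))\<^sup>2) * a n
     + P * R * (\<Sum>j\<in>M. b j * buoy_u k j n) - P * S * (\<Sum>j\<in>N. a j * rot_u k j n)
     - (\<Sum>i\<in>N. \<Sum>j\<in>N. a i * a j * quad_u k i j n)"

definition coeff_th where
  "coeff_th k N M a b n = - ((kappa k n)\<^sup>2 + (of_int (wave3 n))\<^sup>2) * b n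
     + (\<Sum>j\<in>N. a j * lift_th k j n) - (\<Sum>i\<in>N. \<Sum>j\<in>M. a i * b j * quad_th k i j n)"

lemma vexpand_lincomb:
  "vexpand k N a x + vexpand k N b x = vexpand k N (\<lambda>n. a n + b n) x"
  "vexpand k N a x - vexpand k N b x = vexpand k N (\<lambda>n. a n - b n) x"
  "c *\<^sub>R vexpand k N a x = vexpand k N (\<lambda>n. c * a n) x"
  unfolding vexpand_def
  by (simp_all add: scaleR_left_distrib scaleR_left_diff_distrib sum.distrib sum_subtractf scaleR_sum_right)

lemma fexpand_lincomb:
  "fexpand k N a x + fexpand k N b x = fexpand k N (\<lambda>n. a n + b n) x"
  "fexpand k N a x - fexpand k N b x = fexpand k N (\<lambda>n. a n - b n) x"
  unfolding fexpand_def by (simp_all add: algebra_simps sum.distrib sum_subtractf)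

lemma cross3_e3: "cross3 e3 w = curl3 w"
  by (simp add: cross3_def curl3_def vec_eq_iff forall_3 axis_def)

lemma vexpand_cong: "(\<And>n. n \<in> N \<Longrightarrow> a n = b n) \<Longrightarrow> vexpand k N a x = vexpand k N b x"
  unfolding vexpand_def by (intro sum.cong) auto

text \<open>\<open>vproj\<close> is itself an expansion over \<open>N\<close> whose coefficients are
  brackets; it remains to pull the finite sums out of these brackets, and the Laplacian is
  diagonal.\<close>

lemma u_rhs_vexpand:
  assumes "finite N" "finite M"
  shows "u_rhs R S P k N (vexpand k N a) (fexpand k M b) x = vexpand k N (coeff_u R S P k N M a b) x"
proof -
  have 1: "bracket k (\<lambda>y. (fexpand k M b y *\<^sub>R e3) \<bullet> vbasis k n y) = (\<Sum>j\<in>M. b j * buoy_u k j n)" for n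
  proof -
    have "bracket k (\<lambda>y. (fexpand k M b y *\<^sub>R e3) \<bullet> vbasis k n y) =
        bracket k (\<lambda>y. \<Sum>j\<in>M. b j *\<^sub>R ((fbasis k j y *\<^sub>R e3) \<bullet> vbasis k n y))"
      unfolding fexpand_def by (simp add: sum_distrib_left sum_distrib_right mult_ac)
    then show ?thesis unfolding buoy_u_def
      by (subst (asm) bracket_sum) (auto intro!: assms continuous_intros simp: bracket_cmult)
  qed
  have 2: "bracket k (\<lambda>y. cross3 e3 (vexpand k N a y) \<bullet> vbasis k n y) = (\<Sum>j\<in>N. a j * rot_u k j n)" for n
  proof -
    have "bracket k (\<lambda>y. cross3 e3 (vexpand k N a y) \<bullet> vbasis k n y) =
        bracket k (\<lambda>y. \<Sum>j\<in>N. a j *\<^sub>R (cross3 e3 (vbasis k j y) \<bullet> vbasis k n y))"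
      unfolding vexpand_def cross3_e3 linear_sum[OF linear_curl3] linear_scale[OF linear_curl3]
      by (simp add: inner_sum_left)
    then show ?thesis unfolding rot_u_def
      by (subst (asm) bracket_sum)
        (auto intro!: assms continuous_intros continuous_on_cross simp: bracket_cmult)
  qed
  have 3: "bracket k (\<lambda>y. advect (vexpand k N a) (vexpand k N a) y \<bullet> vbasis k n y) =
     (\<Sum>i\<in>N. \<Sum>j\<in>N. a i * a j * quad_u k i j n)" for n
  proof -
    have "bracket k (\<lambda>y. advect (vexpand k N a) (vexpand k N a) y \<bullet> vbasis k n y) =
        bracket k (\<lambda>y. \<Sum>i\<in>N. \<Sum>j\<in>N. (a i * a j) *\<^sub>R (advect (vbasis k i) (vbasis k j) y \<bullet> vbasis k n y))"
      unfolding advect_vexpand_vexpand by (simp add: inner_sum_left)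
    also have "\<dots> = (\<Sum>i\<in>N. bracket k (\<lambda>y. \<Sum>j\<in>N. (a i * a j) *\<^sub>R (advect (vbasis k i) (vbasis k j) y \<bullet> vbasis k n y)))"
      by (intro bracket_sum continuous_intros assms)
    also have "\<dots> = (\<Sum>i\<in>N. \<Sum>j\<in>N. a i * a j * quad_u k i j n)"
      unfolding quad_u_def
      by (intro sum.cong refl, subst bracket_sum) (auto intro!: assms continuous_intros simp: bracket_cmult)
    finally show ?thesis .
  qed
  show ?thesis
    unfolding u_rhs_def laplacian_vexpand vproj_def 1 2 3 vexpand_lincomb
    by (intro vexpand_cong) (simp add: coeff_u_def, simp add: algebra_simps)
qed

lemma th_rhs_fexpand:
  assumes "finite N" "finite M"
  shows "th_rhs k M (vexpand k N a) (fexpand k M b) x = fexpand k M (coeff_th k N M a b) x"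
proof -
  have 1: "bracket k (\<lambda>y. vexpand k N a y $ 3 * fbasis k n y) = (\<Sum>j\<in>N. a j * lift_th k j n)" for n
  proof -
    have "bracket k (\<lambda>y. vexpand k N a y $ 3 * fbasis k n y) =
        bracket k (\<lambda>y. \<Sum>j\<in>N. a j *\<^sub>R (vbasis k j y $ 3 * fbasis k n y))"
      unfolding vexpand_def by (simp add: sum_distrib_left sum_distrib_right mult_ac)
    then show ?thesis unfolding lift_th_def
      by (subst (asm) bracket_sum) (auto intro!: assms continuous_intros simp: bracket_cmult)
  qed
  have 3: "bracket k (\<lambda>y. advect (vexpand k N a) (fexpand k M b) y * fbasis k n y) =
     (\<Sum>i\<in>N. \<Sum>j\<in>M. a i * b j * quad_th k i j n)" for n
  proof -
    have "bracket k (\<lambda>y. advect (vexpand k N a) (fexpand k M b) y * fbasis k n y) =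
        bracket k (\<lambda>y. \<Sum>i\<in>N. \<Sum>j\<in>M. (a i * b j) *\<^sub>R (advect (vbasis k i) (fbasis k j) y * fbasis k n y))"
      unfolding advect_vexpand_fexpand by (simp add: sum_distrib_left sum_distrib_right mult_ac)
    also have "\<dots> = (\<Sum>i\<in>N. bracket k (\<lambda>y. \<Sum>j\<in>M. (a i * b j) *\<^sub>R (advect (vbasis k i) (fbasis k j) y * fbasis k n y)))"
      by (intro bracket_sum continuous_intros assms)
    also have "\<dots> = (\<Sum>i\<in>N. \<Sum>j\<in>M. a i * b j * quad_th k i j n)"
      unfolding quad_th_def
      by (intro sum.cong refl, subst bracket_sum) (auto intro!: assms continuous_intros simp: bracket_cmult)
    finally show ?thesis .
  qed
  show ?thesis
    unfolding th_rhs_def laplacian_fexpand fproj_def 1 3 fexpand_lincomb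
    by (simp add: coeff_th_def[abs_def])
qed

section \<open>Interactions with the mean modes\<close>

lemma vbasis_mean:
  assumes "n \<in> Nu" "wave1 n = 0"
  shows "vbasis k n (x, z) = cos (of_int (wave3 n) * z) *\<^sub>R cos_dir k n"
  using assms NuD(5)[OF assms]
  by (simp add: vbasis_trig trig_def Xf_def Yf_def kappa_def sin_dir_def vec_eq_iff forall_3)

text \<open>Buoyancy points along \<open>e3\<close>, whereas the mean modes are horizontal.\<close>

lemma buoy_u_mean:
  assumes "n \<in> Nu" "wave1 n = 0"
  shows "buoy_u k j n = 0"
proof -
  have "e3 \<bullet> vbasis k n x = 0" for x
    using vbasis_mean[OF assms, of k "fst x" "snd x"] by (simp add: cos_dir_def inner_axis')
  then show ?thesis by (simp add: buoy_u_def bracket_def)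
qed

lemma continuous_on_Xf_UNIV: "continuous_on UNIV (Xf k n)" and continuous_on_Yf_UNIV: "continuous_on UNIV (Yf k n)"
  using continuous_on_Xf[OF continuous_on_id] continuous_on_Yf[OF continuous_on_id] by (simp_all add: id_def)

text \<open>The test mode does not depend on the horizontal variable, so only mean modes are seen;
  orthogonality of cosines then requires equal vertical wave numbers. The factor is (2 pi / k) (pi /
  2).\<close>

lemma rot_u_mean:
  assumes k: "k > 0" and n: "n \<in> Nu" "wave1 n = 0" and j: "j \<in> Nu"
  shows "rot_u k j n = (if wave1 j = 0 \<and> wave3 j = wave3 n then pi\<^sup>2 / k * (curl3 (cos_dir k j) \<bullet> cos_dir k n) else 0)"
proof -
  have "cross3 e3 (vbasis k j (x, z)) \<bullet> vbasis k n (x, z) =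
     (Xf k j x * (cos (of_int (wave3 j) * z) * cos (of_int (wave3 n) * z))) *\<^sub>R (curl3 (cos_dir k j) \<bullet> cos_dir k n)" for x z
    unfolding vbasis_mean[OF n] cross3_e3 vbasis_trig[of k j] trig_linear[OF linear_curl3]
    by (simp add: trig_def linear_0[OF linear_curl3] inner_add_left)
      (simp add: curl3_def sin_dir_def cos_dir_def inner_vec_def sum_3)
  then have "rot_u k j n = bracket k (\<lambda>(x, z).
     (Xf k j x * (cos (of_int (wave3 j) * z) * cos (of_int (wave3 n) * z))) *\<^sub>R (curl3 (cos_dir k j) \<bullet> cos_dir k n))"
    unfolding rot_u_def by (intro arg_cong[where f = "bracket k"]) auto
  also have "\<dots> = ((if wave1 j = 0 then 2 * pi / k else 0) * (pi / 2 * of_bool (wave3 j = wave3 n)))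
      *\<^sub>R (curl3 (cos_dir k j) \<bullet> cos_dir k n)"
    using NuD(2)[OF j] NuD(7)[OF n]
    by (intro bracket_separable k has_integral_Xf j has_integral_cos_cos continuous_on_Xf_UNIV continuous_intros) auto
  finally show ?thesis by (cases "wave1 j = 0"; cases "wave3 j = wave3 n"; simp add: power2_eq_square)
qed

text \<open>With vertical wave numbers a, b, horizontal advection contributes a times (sum +
  difference indicator) and vertical advection b times (difference - sum indicator) with
  \<open>coupling j i\<close>. Antisymmetry of the coupling turns the total into the weights a + b
  and a - b.\<close>

lemma quad_u_mean:
  assumes k: "k > 0" and n: "n \<in> Nu" "wave1 n = 0" and i: "i \<in> Nu" and j: "j \<in> Nu"
  shows "quad_u k i j n = stream_amp k i * (cos_dir k j \<bullet> cos_dir k n) * coupling i j * (pi / 4) *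
     (of_int (wave3 i + wave3 j) * of_bool (wave3 i + wave3 j = wave3 n)
      + of_int (wave3 i - wave3 j) * of_bool (\<bar>wave3 i - wave3 j\<bar> = wave3 n))"
proof -
  let ?a = "wave3 i" and ?b = "wave3 j" and ?m = "wave3 n"
  let ?c = "cos_dir k j \<bullet> cos_dir k n"
  let ?f = "\<lambda>(x, z). (Xf k i x * (kappa k j * Yf k j x) *
       (cos (of_int ?a * z) * cos (of_int ?b * z) * cos (of_int ?m * z))) *\<^sub>R (stream_amp k i * of_int ?a * ?c)"
  let ?g = "\<lambda>(x, z). (Xf k j x * (kappa k i * Yf k i x) *
       (sin (of_int ?a * z) * sin (of_int ?b * z) * cos (of_int ?m * z))) *\<^sub>R (stream_amp k i * of_int ?b * ?c)"
  have "advect (vbasis k i) (vbasis k j) (x, z) \<bullet> vbasis k n (x, z) = ?f (x, z) + ?g (x, z)" for x z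
  proof -
    have "sin_dir k j \<bullet> cos_dir k n = 0" by (simp add: sin_dir_def cos_dir_def inner_vec_def sum_3)
    moreover have "vbasis k i (x, z) $ 1 = Xf k i x * cos (of_int ?a * z) * (stream_amp k i * of_int ?a)"
      "vbasis k i (x, z) $ 3 = - (Yf k i x * sin (of_int ?a * z) * (stream_amp k i * kappa k i))"
      unfolding vbasis_trig by (simp_all add: trig_def cos_dir_def sin_dir_def)
    ultimately show ?thesis
      unfolding vbasis_mean[OF n] advect_def vbasis_trig[of k j] d1_trig d3_trig
      by (simp add: trig_def inner_add_left inner_diff_left) (simp add: algebra_simps)
  qed
  then have "quad_u k i j n = bracket k (\<lambda>x. ?f x + ?g x)"
    unfolding quad_u_def by (intro arg_cong[where f = "bracket k"]) auto
  also have "\<dots> = bracket k ?f + bracket k ?g"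
    unfolding case_prod_unfold by (intro bracket_add continuous_intros)
  also have "bracket k ?f = (coupling i j * (pi / 4 * (of_bool (?a + ?b = ?m) + of_bool (\<bar>?a - ?b\<bar> = ?m))))
      *\<^sub>R (stream_amp k i * of_int ?a * ?c)"
    using NuD(2)[OF i] NuD(2)[OF j] NuD(7)[OF n]
    by (intro bracket_separable k has_integral_Xf_Yf i j has_integral_cos_cos_cos continuous_on_Xf_UNIV
        continuous_on_Yf_UNIV continuous_intros) auto
  also have "bracket k ?g = (coupling j i * (pi / 4 * (of_bool (\<bar>?a - ?b\<bar> = ?m) - of_bool (?a + ?b = ?m))))
      *\<^sub>R (stream_amp k i * of_int ?b * ?c)"
    using NuD(2)[OF i] NuD(2)[OF j] NuD(7)[OF n]
    by (intro bracket_separable k has_integral_Xf_Yf i j has_integral_sin_sin_cos continuous_on_Xf_UNIV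
        continuous_on_Yf_UNIV continuous_intros) auto
  finally show ?thesis
    unfolding coupling_sym[OF i j] by (simp add: algebra_simps)
qed

section \<open>Mean vortex stretching\<close>

lemma has_integral_period_derivative:
  assumes "k > 0" "\<And>x. (f has_real_derivative f' x) (at x)" "f (2 * pi / k) = f 0"
  shows "(f' has_integral 0) {0..2 * pi / k}"
  using fundamental_theorem_of_calculus[of 0 "2 * pi / k" f f'] assms
  by (auto simp flip: has_real_derivative_iff_has_vector_derivative intro: DERIV_subset)

text \<open>The horizontal-axis and vertical vorticity components that advect come from the swirl of
  mode j only. The four resulting terms pair up so that each pair contains the vertical integral of
  a total derivative; hence only boundary values enter, and the individual integrals stay
  unevaluated.\<close>

lemma bracket_stretching_pair:
  assumes k: "k > 0" and i: "i \<in> Nu" and j: "j \<in> Nu"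
  shows "bracket k (advect (curl (vbasis k j)) (vbasis k i)) =
    (- 2 * swirl_amp k j * coupling i j * of_bool (odd (wave3 i + wave3 j))) *\<^sub>R cos_dir k i"
proof -
  let ?a = "wave3 i" and ?b = "wave3 j"
  define F where "F = integral {0..2 * pi / k} (\<lambda>x. Xf k j x * Xf k i x)"
  have F: "((\<lambda>x. Xf k j x * Xf k i x) has_integral F) {0..2 * pi / k}"
    unfolding F_def by (intro integrable_integral integrable_continuous_real continuous_intros)
  \<comment> \<open>Integration by parts over a period: the derivative of the product
    \<open>Xf k j\<close> times \<open>Yf k i\<close> has mean zero, which expresses the YY integral
    by \<open>F\<close>.\<close>
  have dXY: "((\<lambda>x. Xf k j x * Yf k i x) has_real_derivative
      kappa k j * Yf k j x * Yf k i x - kappa k i * (Xf k j x * Xf k i x)) (at x)" for x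
    by (rule DERIV_cong, rule DERIV_mult[OF Xf_deriv Yf_deriv]) (simp add: algebra_simps)
  have "((\<lambda>x. kappa k j * Yf k j x * Yf k i x - kappa k i * (Xf k j x * Xf k i x)) has_integral 0) {0..2 * pi / k}"
    by (rule has_integral_period_derivative[OF k dXY]) (simp add: XYf_period[OF k])
  from has_integral_add[OF this has_integral_mult_right[OF F, of "kappa k i"]]
  have G: "((\<lambda>x. kappa k j * Yf k j x * Yf k i x) has_integral kappa k i * F) {0..2 * pi / k}" by simp
  \<comment> \<open>The integrand is the derivative of - cos (a z) cos (b z), with boundary
    contribution 1 - (-1)^(a + b).\<close>
  have z1: "((\<lambda>z. of_int ?b * (sin (of_int ?b * z) * cos (of_int ?a * z))
      + of_int ?a * (cos (of_int ?b * z) * sin (of_int ?a * z))) has_integral 2 * of_bool (odd (?a + ?b))) {0..pi}"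
  proof -
    have "((\<lambda>z. of_int ?b * (sin (of_int ?b * z) * cos (of_int ?a * z))
      + of_int ?a * (cos (of_int ?b * z) * sin (of_int ?a * z))) has_integral
        (- (cos (of_int ?a * pi) * cos (of_int ?b * pi))) - (- (cos (of_int ?a * 0) * cos (of_int ?b * 0)))) {0..pi}"
      by (intro fundamental_theorem_of_calculus)
       (auto intro!: derivative_eq_intros simp: algebra_simps simp flip: has_real_derivative_iff_has_vector_derivative)
    then show ?thesis by (auto simp: cos_int_pi split: if_splits)
  qed
  \<comment> \<open>The integrand is the derivative of sin (a z) cos (b z), which is zero at both
    walls.\<close>
  have z2: "((\<lambda>z. - of_int ?b * (sin (of_int ?b * z) * sin (of_int ?a * z))
      + of_int ?a * (cos (of_int ?b * z) * cos (of_int ?a * z))) has_integral 0) {0..pi}"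
  proof -
    have "((\<lambda>z. - of_int ?b * (sin (of_int ?b * z) * sin (of_int ?a * z))
      + of_int ?a * (cos (of_int ?b * z) * cos (of_int ?a * z))) has_integral
        (sin (of_int ?a * pi) * cos (of_int ?b * pi)) - (sin (of_int ?a * 0) * cos (of_int ?b * 0))) {0..pi}"
      by (intro fundamental_theorem_of_calculus)
       (auto intro!: derivative_eq_intros simp: algebra_simps simp flip: has_real_derivative_iff_has_vector_derivative)
    moreover have "sin (real_of_int ?a * pi) = 0" by (simp add: sin_zero_iff_int2)
    ultimately show ?thesis by simp
  qed
  have int: "(f has_integral integral {0..pi} f) {0..pi}" if "continuous_on {0..pi} f" for f :: "real \<Rightarrow> real"
    using that by (intro integrable_integral integrable_continuous_real)
  let ?sc = "\<lambda>z. sin (of_int ?b * z) * cos (of_int ?a * z)" and ?cs = "\<lambda>z. cos (of_int ?b * z) * sin (of_int ?a * z)"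
    and ?ss = "\<lambda>z. sin (of_int ?b * z) * sin (of_int ?a * z)" and ?cc = "\<lambda>z. cos (of_int ?b * z) * cos (of_int ?a * z)"
  have sc: "(?sc has_integral integral {0..pi} ?sc) {0..pi}" and cs: "(?cs has_integral integral {0..pi} ?cs) {0..pi}"
    and ss: "(?ss has_integral integral {0..pi} ?ss) {0..pi}" and cc: "(?cc has_integral integral {0..pi} ?cc) {0..pi}"
    by (intro int continuous_intros)+
  have e1: "of_int ?b * integral {0..pi} ?sc + of_int ?a * integral {0..pi} ?cs = 2 * of_bool (odd (?a + ?b))"
    by (rule has_integral_unique[OF has_integral_add[OF has_integral_mult_right[OF sc] has_integral_mult_right[OF cs]] z1])
  have e2: "- of_int ?b * integral {0..pi} ?ss + of_int ?a * integral {0..pi} ?cc = 0"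
    by (rule has_integral_unique[OF has_integral_add[OF has_integral_mult_right[OF ss] has_integral_mult_right[OF cc]] z2])
  let ?f1 = "\<lambda>(x, z). (Xf k j x * (kappa k i * Yf k i x) * ?sc z) *\<^sub>R ((swirl_amp k j * of_int ?b) *\<^sub>R cos_dir k i)"
  let ?f2 = "\<lambda>(x, z). (Xf k i x * (kappa k j * Yf k j x) * ?cs z) *\<^sub>R ((- swirl_amp k j * of_int ?a) *\<^sub>R cos_dir k i)"
  let ?f3 = "\<lambda>(x, z). (Xf k j x * Xf k i x * ?ss z) *\<^sub>R ((- swirl_amp k j * of_int ?b * kappa k i) *\<^sub>R sin_dir k i)"
  let ?f4 = "\<lambda>(x, z). (kappa k j * Yf k j x * Yf k i x * ?cc z) *\<^sub>R ((swirl_amp k j * of_int ?a) *\<^sub>R sin_dir k i)"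
  have "advect (curl (vbasis k j)) (vbasis k i) (x, z) = ?f1 (x, z) + ?f2 (x, z) + ?f3 (x, z) + ?f4 (x, z)" for x z
  proof -
    have "curl (vbasis k j) (x, z) $ 1 = of_int ?b * Xf k j x * sin (of_int ?b * z) * swirl_amp k j"
      "curl (vbasis k j) (x, z) $ 3 = kappa k j * Yf k j x * cos (of_int ?b * z) * swirl_amp k j"
      unfolding curl_def vbasis_trig d1_trig d3_trig by (simp_all add: trig_def cos_dir_def sin_dir_def)
    then show ?thesis
      unfolding advect_def vbasis_trig[of k i] d1_trig d3_trig
      by (simp add: trig_def algebra_simps)
  qed
  then have "bracket k (advect (curl (vbasis k j)) (vbasis k i)) = bracket k (\<lambda>x. ?f1 x + ?f2 x + ?f3 x + ?f4 x)"
    by (intro arg_cong[where f = "bracket k"]) auto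
  also have "\<dots> = bracket k ?f1 + bracket k ?f2 + bracket k ?f3 + bracket k ?f4"
    unfolding case_prod_unfold by (subst bracket_add[symmetric]; (intro continuous_intros)?)+ simp
  also have "bracket k ?f1 = (coupling j i * integral {0..pi} ?sc) *\<^sub>R ((swirl_amp k j * of_int ?b) *\<^sub>R cos_dir k i)"
    by (intro bracket_separable k has_integral_Xf_Yf i j sc continuous_on_Xf_UNIV
        continuous_on_Yf_UNIV continuous_intros)
  also have "bracket k ?f2 = (coupling i j * integral {0..pi} ?cs) *\<^sub>R ((- swirl_amp k j * of_int ?a) *\<^sub>R cos_dir k i)"
    by (intro bracket_separable k has_integral_Xf_Yf i j cs continuous_on_Xf_UNIV
        continuous_on_Yf_UNIV continuous_intros)
  also have "bracket k ?f3 = (F * integral {0..pi} ?ss) *\<^sub>R ((- swirl_amp k j * of_int ?b * kappa k i) *\<^sub>R sin_dir k i)"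
    by (intro bracket_separable k F ss continuous_on_Xf_UNIV continuous_intros)
  also have "bracket k ?f4 = (kappa k i * F * integral {0..pi} ?cc) *\<^sub>R ((swirl_amp k j * of_int ?a) *\<^sub>R sin_dir k i)"
    by (intro bracket_separable k G cc continuous_on_Yf_UNIV continuous_intros)
  also have "(coupling j i * integral {0..pi} ?sc) *\<^sub>R ((swirl_amp k j * of_int ?b) *\<^sub>R cos_dir k i)
      + (coupling i j * integral {0..pi} ?cs) *\<^sub>R ((- swirl_amp k j * of_int ?a) *\<^sub>R cos_dir k i)
      + (F * integral {0..pi} ?ss) *\<^sub>R ((- swirl_amp k j * of_int ?b * kappa k i) *\<^sub>R sin_dir k i)
      + (kappa k i * F * integral {0..pi} ?cc) *\<^sub>R ((swirl_amp k j * of_int ?a) *\<^sub>R sin_dir k i)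
    = (- coupling i j * swirl_amp k j * (of_int ?b * integral {0..pi} ?sc + of_int ?a * integral {0..pi} ?cs)) *\<^sub>R cos_dir k i
      + (F * swirl_amp k j * kappa k i * (- of_int ?b * integral {0..pi} ?ss + of_int ?a * integral {0..pi} ?cc)) *\<^sub>R sin_dir k i"
    unfolding coupling_sym[OF i j] by (simp add: algebra_simps)
  finally show ?thesis unfolding e1 e2 by (simp add: mult_ac)
qed

text \<open>The common amplitude of all mean velocity modes: eta contributes 1 / sqrt 2, and for
  component 1 the quotient of the vertical wave number by \<open>Knorm\<close> is 1. Its square k /
  pi^2 cancels the constants of the mean interactions.\<close>

definition mean_amp :: "real \<Rightarrow> real" where "mean_amp k = 1 / (sqrt 2 * Vnorm k)"

lemma mean_amp_sq: "k > 0 \<Longrightarrow> mean_amp k * mean_amp k = k / pi\<^sup>2"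
proof -
  assume k: "k > 0"
  have "Vnorm k * Vnorm k = pi\<^sup>2 / (2 * k)" using k by (simp add: Vnorm_def)
  then have "mean_amp k * mean_amp k = 1 / (2 * (pi\<^sup>2 / (2 * k)))"
    by (simp add: mean_amp_def mult_ac flip: mult.assoc) 
  then show ?thesis using k by simp
qed

lemma mean_amp_pos: "k > 0 \<Longrightarrow> mean_amp k > 0"
  by (simp add: mean_amp_def Vnorm_def)

lemma cos_dir_mean:
  assumes "n \<in> Nu" "wave1 n = 0"
  shows "cos_dir k n = mean_amp k *\<^sub>R (if mode_comp n = 1 then axis 1 1 else e2)"
  using NuD(7)[OF assms] assms
  by (auto simp: cos_dir_def stream_amp_def swirl_amp_def Knorm_def mean_amp_def eta_def eta1_def vec_eq_iff forall_3 axis_def)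

lemma curl3_axis: "curl3 (axis 1 1) = e2" "curl3 e2 = - axis 1 1"
  by (simp_all add: curl3_def vec_eq_iff forall_3 axis_def)

section \<open>The defect of the vorticity balance\<close>

text \<open>The Coriolis partner of a mode: rotation about \<open>e3\<close> exchanges the two
  horizontal directions of the mean modes.\<close>

definition flip :: "mode \<Rightarrow> mode" where
  "flip n = (wave1 n, wave3 n, phase n, rep2 (mode_comp n + 1))"

text \<open>Oddness is built in because mean modes of even vertical wave number do not contribute to
  the mean vorticity; phase 2 is the only phase of a mean mode in \<open>Nu\<close>.\<close>

definition has_mean :: "mode set \<Rightarrow> int \<Rightarrow> int \<Rightarrow> real" where
  "has_mean N c q = of_bool (odd q \<and> (0, q, 2, c) \<in> N)"

text \<open>
  The \<open>x\<^sub>1\<close>-average of \<open>u \<cdot> \<nabla> u\<^sub>c\<close> for a pair of modes with vertical wave numbers \<open>a, b\<close> is proportional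
  to \<open>(a + b) cos ((a + b) x\<^sub>3) + (a - b) cos ((a - b) x\<^sub>3)\<close>. The projection keeps a frequency
  only if the corresponding mean mode belongs to the index set.
\<close>

definition transfer :: "mode set \<Rightarrow> int \<Rightarrow> mode \<Rightarrow> mode \<Rightarrow> real" where
  "transfer N c i j = of_int (wave3 i + wave3 j) * has_mean N c (wave3 i + wave3 j)
     + of_int (wave3 i - wave3 j) * has_mean N c \<bar>wave3 i - wave3 j\<bar>"

text \<open>The quadratic part of the defect along the first axis. The subtracted term is vortex
  stretching; if both frequencies of an odd pair are present, the transfer is (a + b) + (a - b) = 2a
  and compensates it exactly.\<close>

definition defect1 where
  "defect1 k N a = (\<Sum>i\<in>N. \<Sum>j\<in>N. a i * a j * (stream_amp k i * swirl_amp k j * coupling i j *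
     (transfer N 2 i j - 2 * of_int (wave3 i) * of_bool (odd (wave3 i + wave3 j)))))"

text \<open>The part along \<open>e2\<close>, where stretching has no net contribution.\<close>

definition defect2 where
  "defect2 k N a = (\<Sum>i\<in>N. \<Sum>j\<in>N. a i * a j * (stream_amp k i * (stream_amp k j * of_int (wave3 j)) * coupling i j * transfer N 1 i j))"

definition rot_defect where
  "rot_defect k N a = (\<Sum>j\<in>{n\<in>N. odd_mean n \<and> flip n \<notin> N}. a j *\<^sub>R cos_dir k j)"

lemma mode_eq_iff: "n = (m1, m3, p, c) \<longleftrightarrow> wave1 n = m1 \<and> wave3 n = m3 \<and> phase n = p \<and> mode_comp n = c"
  by (cases n) auto

lemma flip_Nu:
  assumes "n \<in> Nu" "odd_mean n"
  shows "flip (flip n) = n" "odd_mean (flip n)" "mode_comp (flip n) = 3 - mode_comp n" "wave3 (flip n) = wave3 n" "flip n \<noteq> n"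
  using assms NuD(4)[OF assms(1)] by (cases n; auto simp: flip_def odd_mean_def rep2_def)+

lemma cos_dir_axes: "cos_dir k n = (stream_amp k n * of_int (wave3 n)) *\<^sub>R axis 1 1 + swirl_amp k n *\<^sub>R e2"
  by (simp add: cos_dir_def vec_eq_iff forall_3 axis_def)

context
  fixes k :: real and N :: "mode set"
  assumes k: "k > 0" and N: "finite N" "N \<subseteq> Nu"
begin

text \<open>\<open>curl3\<close> maps the first axis to \<open>e2\<close> and \<open>e2\<close> to
  minus the first axis. Thus mean modes of component 1 feed the \<open>e2\<close> part of the
  vorticity and those of component 2 the other part, with a sign.\<close>

lemma sum_quad_u_mean:
  assumes "i \<in> N" "j \<in> N"
  shows "(4 * pi / k) *\<^sub>R (\<Sum>n\<in>{n\<in>N. odd_mean n}. quad_u k i j n *\<^sub>R curl3 (cos_dir k n)) =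
    (stream_amp k i * (stream_amp k j * of_int (wave3 j)) * coupling i j * transfer N 1 i j) *\<^sub>R e2
    - (stream_amp k i * swirl_amp k j * coupling i j * transfer N 2 i j) *\<^sub>R axis 1 1"
proof -
  have ij: "i \<in> Nu" "j \<in> Nu" using assms N by auto
  let ?Nc = "\<lambda>c. {n\<in>N. odd_mean n \<and> mode_comp n = c}"
  let ?s = "wave3 i + wave3 j" and ?d = "\<bar>wave3 i - wave3 j\<bar>"
  let ?w = "\<lambda>n. real_of_int ?s * of_bool (?s = wave3 n) + of_int (wave3 i - wave3 j) * of_bool (?d = wave3 n)"
  \<comment> \<open>Mean modes have phase 2, so a component and a vertical wave number determine at
    most one of them.\<close>
  have mean_sum: "(\<Sum>n\<in>?Nc c. of_bool (q = wave3 n)) = has_mean N c q" for c q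
  proof -
    have "(\<Sum>n\<in>?Nc c. of_bool (q = wave3 n)) = (\<Sum>n\<in>?Nc c. if n = (0, q, 2, c) then 1 else 0 :: real)"
    proof (intro sum.cong refl)
      fix n assume "n \<in> ?Nc c"
      then show "of_bool (q = wave3 n) = (if n = (0, q, 2, c) then 1 else 0 :: real)"
        using NuD(5)[of n] N unfolding mode_eq_iff by (auto simp: odd_mean_def)
    qed
    also have "\<dots> = has_mean N c q"
      using N by (auto simp: has_mean_def odd_mean_def)
    finally show ?thesis .
  qed
  have w: "(\<Sum>n\<in>?Nc c. ?w n) = transfer N c i j" for c
    by (simp only: sum.distrib sum_distrib_left[symmetric] mean_sum transfer_def)
  let ?g = "\<lambda>n. (4 * pi / k) *\<^sub>R (quad_u k i j n *\<^sub>R curl3 (cos_dir k n))"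
  have g: "?g n = (if mode_comp n = 1 then (stream_amp k i * (stream_amp k j * of_int (wave3 j)) * coupling i j * ?w n) *\<^sub>R e2
        else - ((stream_amp k i * swirl_amp k j * coupling i j * ?w n) *\<^sub>R axis 1 1))"
    if "n \<in> N" "odd_mean n" for n
  proof -
    have n: "n \<in> Nu" "wave1 n = 0" using that N by (auto simp: odd_mean_def)
    \<comment> \<open>The normalization of the two mean modes cancels the constants of the curl
      bracket and of the triple cosine integral.\<close>
    have "(4 * pi / k) * (mean_amp k * mean_amp k) * (pi / 4) = 1"
      unfolding mean_amp_sq[OF k] using k by (simp add: power2_eq_square)
    then have *: "4 * pi / k * (x * (y * mean_amp k) * z * (pi / 4) * v) * mean_amp k = x * y * z * v" for x y z v
      by (metis (no_types, opaque_lifting) mult.assoc mult.commute mult.left_neutral)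
    have "?g n = (4 * pi / k * (stream_amp k i * (cos_dir k j \<bullet> (if mode_comp n = 1 then axis 1 1 else e2) * mean_amp k) * coupling i j * (pi / 4) * ?w n)
         * mean_amp k) *\<^sub>R curl3 (if mode_comp n = 1 then axis 1 1 else e2)"
      unfolding quad_u_mean[OF k n ij] cos_dir_mean[OF n] linear_scale[OF linear_curl3] by (simp add: mult_ac)
    then show ?thesis
      unfolding * by (auto simp: curl3_axis inner_axis cos_dir_def)
  qed
  have "(4 * pi / k) *\<^sub>R (\<Sum>n\<in>{n\<in>N. odd_mean n}. quad_u k i j n *\<^sub>R curl3 (cos_dir k n)) =
     (\<Sum>n\<in>{n\<in>N. odd_mean n}. ?g n)" by (simp add: scaleR_sum_right)
  also have "\<dots> = (\<Sum>n\<in>?Nc 1. ?g n) + (\<Sum>n\<in>?Nc 2. ?g n)"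
  proof -
    have "{n\<in>N. odd_mean n} = ?Nc 1 \<union> ?Nc 2" using NuD(4) N(2) by blast
    then show ?thesis using N by (simp only:) (intro sum.union_disjoint; auto)
  qed
  also have "(\<Sum>n\<in>?Nc 1. ?g n) = (\<Sum>n\<in>?Nc 1. (stream_amp k i * (stream_amp k j * of_int (wave3 j)) * coupling i j * ?w n) *\<^sub>R e2)"
    by (intro sum.cong refl) (subst g; simp)
  also have "\<dots> = (stream_amp k i * (stream_amp k j * of_int (wave3 j)) * coupling i j * transfer N 1 i j) *\<^sub>R e2"
    unfolding w[symmetric] by (simp only: scaleR_sum_left sum_distrib_left)
  also have "(\<Sum>n\<in>?Nc 2. ?g n) = (\<Sum>n\<in>?Nc 2. - ((stream_amp k i * swirl_amp k j * coupling i j * ?w n) *\<^sub>R axis 1 1))"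
    by (intro sum.cong refl) (subst g; simp)
  also have "\<dots> = - ((stream_amp k i * swirl_amp k j * coupling i j * transfer N 2 i j) *\<^sub>R axis 1 1)"
    unfolding w[symmetric] by (simp only: scaleR_sum_left sum_distrib_left sum_negf)
  finally show ?thesis by simp
qed

text \<open>Each odd mean mode is driven by its partner alone, and applying \<open>curl3\<close>
  twice reverses horizontal vectors. Since \<open>flip\<close> is an involution, reindexing gives
  minus the sum over all modes with a partner; the modes without one make up
  \<open>rot_defect\<close>.\<close>

lemma sum_rot_u_mean:
  "(\<Sum>n\<in>{n\<in>N. odd_mean n}. (\<Sum>j\<in>N. a j * rot_u k j n) *\<^sub>R curl3 (cos_dir k n)) =
     rot_defect k N a - (\<Sum>n\<in>{n\<in>N. odd_mean n}. a n *\<^sub>R cos_dir k n)"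
proof -
  let ?M = "{n\<in>N. odd_mean n}" and ?F = "{n\<in>N. odd_mean n \<and> flip n \<in> N}"
  have mode_term: "(\<Sum>j\<in>N. a j * rot_u k j n) *\<^sub>R curl3 (cos_dir k n) =
      (if flip n \<in> N then - (a (flip n) *\<^sub>R cos_dir k (flip n)) else 0)" if "n \<in> ?M" for n
  proof -
    have n: "n \<in> Nu" "wave1 n = 0" "odd_mean n" using that N by (auto simp: odd_mean_def)
    note fn = flip_Nu[OF n(1,3)]
    have "(\<Sum>j\<in>N. a j * rot_u k j n) = (\<Sum>j\<in>N. if j = flip n then a j * rot_u k j n else 0)"
    proof (intro sum.cong refl)
      fix j assume "j \<in> N"
      then have j: "j \<in> Nu" using N by auto
      have "rot_u k j n = 0" if "j \<noteq> flip n"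
      proof (cases "wave1 j = 0 \<and> wave3 j = wave3 n")
        case True
        then have "mode_comp j = mode_comp n"
          using that NuD(4)[OF j] NuD(4)[OF n(1)] NuD(5)[OF j] NuD(5)[OF n(1)] n(2)
          by (auto simp: flip_def mode_eq_iff rep2_def)
        then show ?thesis
          unfolding rot_u_mean[OF k n(1,2) j] using True cos_dir_mean[OF j, of k] cos_dir_mean[OF n(1,2), of k]
          by (simp add: linear_scale[OF linear_curl3] curl3_axis inner_axis_axis)
      qed (auto simp: rot_u_mean[OF k n(1,2) j])
      then show "a j * rot_u k j n = (if j = flip n then a j * rot_u k j n else 0)" by auto
    qed
    also have "\<dots> = (if flip n \<in> N then a (flip n) * rot_u k (flip n) n else 0)"
      using N by simp
    finally have s: "(\<Sum>j\<in>N. a j * rot_u k j n) = (if flip n \<in> N then a (flip n) * rot_u k (flip n) n else 0)" .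
    show ?thesis
    proof (cases "flip n \<in> N")
      case True
      then have f: "flip n \<in> Nu" "wave1 (flip n) = 0" using N fn(2) by (auto simp: odd_mean_def)
      have kk: "pi\<^sup>2 / k * (mean_amp k * mean_amp k) = 1" using k by (simp add: mean_amp_sq)
      have "rot_u k (flip n) n *\<^sub>R curl3 (cos_dir k n) = - cos_dir k (flip n)"
        unfolding rot_u_mean[OF k n(1,2) f(1)] using f(2) fn(3,4) NuD(4)[OF n(1)] kk k
        by (auto simp: cos_dir_mean[OF n(1,2)] cos_dir_mean[OF f] linear_scale[OF linear_curl3] curl3_axis
            inner_axis_axis scaleR_scaleR mult_ac)
      with True show ?thesis unfolding s by (simp flip: scaleR_scaleR)
    qed (simp add: s)
  qed
  have "(\<Sum>n\<in>?M. (\<Sum>j\<in>N. a j * rot_u k j n) *\<^sub>R curl3 (cos_dir k n)) =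
      (\<Sum>n\<in>?M. if flip n \<in> N then - (a (flip n) *\<^sub>R cos_dir k (flip n)) else 0)"
    by (intro sum.cong refl mode_term)
  also have "\<dots> = (\<Sum>n\<in>?F. - (a (flip n) *\<^sub>R cos_dir k (flip n)))"
    using N by (simp add: sum.inter_filter[symmetric] conj_assoc)
  also have "\<dots> = (\<Sum>n\<in>?F. - (a n *\<^sub>R cos_dir k n))"
  proof -
    have ff: "flip (flip n) = n" "odd_mean (flip n)" if "n \<in> ?F" for n
      using that flip_Nu[of n] N(2) by blast+
    show ?thesis
      by (rule sum.reindex_bij_witness[of _ flip flip]) (use ff in auto)
  qed
  also have "\<dots> = rot_defect k N a - (\<Sum>n\<in>?M. a n *\<^sub>R cos_dir k n)"
  proof -
    have "?M = ?F \<union> {n\<in>N. odd_mean n \<and> flip n \<notin> N}" by auto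
    moreover have "(\<Sum>n\<in>?F \<union> {n\<in>N. odd_mean n \<and> flip n \<notin> N}. a n *\<^sub>R cos_dir k n) = (\<Sum>n\<in>?F. a n *\<^sub>R cos_dir k n) + rot_defect k N a"
      unfolding rot_defect_def using N by (intro sum.union_disjoint) auto
    ultimately show ?thesis by (simp add: sum_negf)
  qed
  finally show ?thesis .
qed

text \<open>Along \<open>e2\<close> the coefficients are a product of two swirl amplitudes with the
  antisymmetric coupling, so the quadratic form vanishes. Only the first axis remains.\<close>

lemma bracket_stretching:
  "bracket k (advect (curl (vexpand k N a)) (vexpand k N a)) =
    - (\<Sum>i\<in>N. \<Sum>j\<in>N. a i * a j * (2 * stream_amp k i * of_int (wave3 i) * swirl_amp k j * coupling i j * of_bool (odd (wave3 i + wave3 j)))) *\<^sub>R axis 1 1"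
proof -
  let ?c = "\<lambda>i j. - 2 * swirl_amp k j * coupling i j * of_bool (odd (wave3 i + wave3 j))"
  have "bracket k (advect (curl (vexpand k N a)) (vexpand k N a)) =
      bracket k (\<lambda>x. \<Sum>j\<in>N. \<Sum>i\<in>N. (a j * a i) *\<^sub>R advect (curl (vbasis k j)) (vbasis k i) x)"
    unfolding advect_curl_vexpand_vexpand[abs_def] ..
  also have "\<dots> = (\<Sum>j\<in>N. bracket k (\<lambda>x. \<Sum>i\<in>N. (a j * a i) *\<^sub>R advect (curl (vbasis k j)) (vbasis k i) x))"
    by (intro bracket_sum continuous_intros N)
  also have "\<dots> = (\<Sum>j\<in>N. \<Sum>i\<in>N. (a j * a i) *\<^sub>R (?c i j *\<^sub>R cos_dir k i))"
  proof (intro sum.cong refl)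
    fix j assume j: "j \<in> N"
    have "bracket k (\<lambda>x. \<Sum>i\<in>N. (a j * a i) *\<^sub>R advect (curl (vbasis k j)) (vbasis k i) x) =
      (\<Sum>i\<in>N. bracket k (\<lambda>x. (a j * a i) *\<^sub>R advect (curl (vbasis k j)) (vbasis k i) x))"
      by (intro bracket_sum continuous_intros N)
    also have "\<dots> = (\<Sum>i\<in>N. (a j * a i) *\<^sub>R (?c i j *\<^sub>R cos_dir k i))"
      unfolding bracket_scaleR using j N by (intro sum.cong refl) (subst bracket_stretching_pair, auto simp: k)
    finally show "bracket k (\<lambda>x. \<Sum>i\<in>N. (a j * a i) *\<^sub>R advect (curl (vbasis k j)) (vbasis k i) x) = \<dots>" .
  qed
  also have "\<dots> = (\<Sum>i\<in>N. \<Sum>j\<in>N. (a j * a i) *\<^sub>R (?c i j *\<^sub>R cos_dir k i))" by (rule sum.swap)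
  also have "\<dots> = (\<Sum>i\<in>N. \<Sum>j\<in>N. a i * a j * (?c i j * stream_amp k i * of_int (wave3 i))) *\<^sub>R axis 1 1
      + (\<Sum>i\<in>N. \<Sum>j\<in>N. a i * a j * (?c i j * swirl_amp k i)) *\<^sub>R e2"
    unfolding cos_dir_axes by (simp only: scaleR_add_right scaleR_scaleR sum.distrib scaleR_sum_left mult_ac)
  also have "(\<Sum>i\<in>N. \<Sum>j\<in>N. a i * a j * (?c i j * swirl_amp k i)) = 0"
  proof -
    have "(\<Sum>i\<in>N. \<Sum>j\<in>N. a i * a j * (?c i j * swirl_amp k i)) = (\<Sum>i\<in>N. \<Sum>j\<in>N. a j * a i * (?c j i * swirl_amp k j))"
      by (rule sum.swap)
    also have "\<dots> = (\<Sum>i\<in>N. \<Sum>j\<in>N. - (a i * a j * (?c i j * swirl_amp k i)))"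
    proof (intro sum.cong refl)
      fix i j assume "i \<in> N" "j \<in> N"
      then have "coupling j i = - coupling i j" using N by (auto intro: coupling_sym)
      then show "a j * a i * (?c j i * swirl_amp k j) = - (a i * a j * (?c i j * swirl_amp k i))"
        by (simp add: mult_ac add.commute)
    qed
    finally show ?thesis by (simp add: sum_negf)
  qed
  also have "(\<Sum>i\<in>N. \<Sum>j\<in>N. a i * a j * (?c i j * stream_amp k i * of_int (wave3 i))) =
      - (\<Sum>i\<in>N. \<Sum>j\<in>N. a i * a j *
          (2 * stream_amp k i * of_int (wave3 i) * swirl_amp k j * coupling i j * of_bool (odd (wave3 i + wave3 j))))"
    unfolding sum_negf[symmetric] by (intro sum.cong refl) simp
  finally show ?thesis by simp
qed

text \<open>On mean modes the Laplacian is the second vertical derivative and buoyancy is absent, so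
  these terms match. The Coriolis term reproduces the vertical derivative of the velocity up to
  \<open>rot_defect\<close>; the projected nonlinearity minus stretching gives the two quadratic
  forms.\<close>

lemma balance_defect:
  "bracket k (curl (vexpand k N (coeff_u R S P k N M a b)))
    - (P *\<^sub>R bracket k (d3 (d3 (curl (vexpand k N a)))) + bracket k (advect (curl (vexpand k N a)) (vexpand k N a))
       + (P * S) *\<^sub>R bracket k (d3 (vexpand k N a)))
   = (4 * pi / k * (P * S)) *\<^sub>R rot_defect k N a - defect1 k N a *\<^sub>R axis 1 1 + defect2 k N a *\<^sub>R e2"
proof -
  let ?M = "{n\<in>N. odd_mean n}"
  let ?K = "4 * pi / k"
  let ?Q = "\<lambda>n. \<Sum>i\<in>N. \<Sum>j\<in>N. a i * a j * quad_u k i j n"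
  let ?Rt = "\<lambda>n. \<Sum>j\<in>N. a j * rot_u k j n"
  have "(\<Sum>n\<in>?M. coeff_u R S P k N M a b n *\<^sub>R curl3 (cos_dir k n)) =
     (\<Sum>n\<in>?M. P *\<^sub>R ((- (of_int (wave3 n))\<^sup>2 * a n) *\<^sub>R curl3 (cos_dir k n)) - (P * S) *\<^sub>R (?Rt n *\<^sub>R curl3 (cos_dir k n))
        - ?Q n *\<^sub>R curl3 (cos_dir k n))"
  proof (intro sum.cong refl)
    fix n assume "n \<in> ?M"
    then have "n \<in> Nu" "wave1 n = 0" using N by (auto simp: odd_mean_def)
    then have "coeff_u R S P k N M a b n = P * (- (of_int (wave3 n))\<^sup>2 * a n) - P * S * ?Rt n - ?Q n"
      by (simp add: coeff_u_def buoy_u_mean kappa_def)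
    then show "coeff_u R S P k N M a b n *\<^sub>R curl3 (cos_dir k n) =
      P *\<^sub>R ((- (of_int (wave3 n))\<^sup>2 * a n) *\<^sub>R curl3 (cos_dir k n)) - (P * S) *\<^sub>R (?Rt n *\<^sub>R curl3 (cos_dir k n))
        - ?Q n *\<^sub>R curl3 (cos_dir k n)"
      by (simp only: scaleR_left_diff_distrib scaleR_scaleR)
  qed
  then have c: "(\<Sum>n\<in>?M. coeff_u R S P k N M a b n *\<^sub>R curl3 (cos_dir k n)) =
     P *\<^sub>R (\<Sum>n\<in>?M. (- (of_int (wave3 n))\<^sup>2 * a n) *\<^sub>R curl3 (cos_dir k n))
     - (P * S) *\<^sub>R (rot_defect k N a - (\<Sum>n\<in>?M. a n *\<^sub>R cos_dir k n)) - (\<Sum>n\<in>?M. ?Q n *\<^sub>R curl3 (cos_dir k n))"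
    by (simp only: sum_subtractf scaleR_sum_right[symmetric] sum_rot_u_mean)
  have q: "?K *\<^sub>R (\<Sum>n\<in>?M. ?Q n *\<^sub>R curl3 (cos_dir k n)) = defect2 k N a *\<^sub>R e2 - (\<Sum>i\<in>N. \<Sum>j\<in>N. a i * a j *
      (stream_amp k i * swirl_amp k j * coupling i j * transfer N 2 i j)) *\<^sub>R axis 1 1"
  proof -
    have "(\<Sum>n\<in>?M. ?Q n *\<^sub>R curl3 (cos_dir k n)) = (\<Sum>n\<in>?M. \<Sum>i\<in>N. \<Sum>j\<in>N. (a i * a j * quad_u k i j n) *\<^sub>R curl3 (cos_dir k n))"
      by (simp only: scaleR_sum_left)
    also have "\<dots> = (\<Sum>i\<in>N. \<Sum>n\<in>?M. \<Sum>j\<in>N. (a i * a j * quad_u k i j n) *\<^sub>R curl3 (cos_dir k n))"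
      by (rule sum.swap)
    also have "\<dots> = (\<Sum>i\<in>N. \<Sum>j\<in>N. \<Sum>n\<in>?M. (a i * a j * quad_u k i j n) *\<^sub>R curl3 (cos_dir k n))"
      by (intro sum.cong refl sum.swap)
    also have "\<dots> = (\<Sum>i\<in>N. \<Sum>j\<in>N. (a i * a j) *\<^sub>R (\<Sum>n\<in>?M. quad_u k i j n *\<^sub>R curl3 (cos_dir k n)))"
      by (simp only: scaleR_sum_right scaleR_scaleR)
    finally have "?K *\<^sub>R (\<Sum>n\<in>?M. ?Q n *\<^sub>R curl3 (cos_dir k n)) =
        (\<Sum>i\<in>N. \<Sum>j\<in>N. (a i * a j) *\<^sub>R (?K *\<^sub>R (\<Sum>n\<in>?M. quad_u k i j n *\<^sub>R curl3 (cos_dir k n))))"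
      by (simp add: scaleR_sum_right mult_ac)
    also have "\<dots> = (\<Sum>i\<in>N. \<Sum>j\<in>N. (a i * a j * (stream_amp k i * (stream_amp k j * of_int (wave3 j)) * coupling i j * transfer N 1 i j)) *\<^sub>R e2
       - (a i * a j * (stream_amp k i * swirl_amp k j * coupling i j * transfer N 2 i j)) *\<^sub>R axis 1 1)"
      by (intro sum.cong refl) (simp only: sum_quad_u_mean scaleR_diff_right scaleR_scaleR)
    finally show ?thesis unfolding defect2_def by (simp only: sum_subtractf scaleR_sum_left)
  qed
  have d1: "defect1 k N a = (\<Sum>i\<in>N. \<Sum>j\<in>N. a i * a j * (stream_amp k i * swirl_amp k j * coupling i j * transfer N 2 i j))
     - (\<Sum>i\<in>N. \<Sum>j\<in>N. a i * a j * (2 * stream_amp k i * of_int (wave3 i) * swirl_amp k j * coupling i j * of_bool (odd (wave3 i + wave3 j))))"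
    unfolding defect1_def by (simp only: sum_subtractf[symmetric]) (intro sum.cong refl, simp add: algebra_simps)
  \<comment> \<open>Here u stands for diffusion, r for the Coriolis defect, v for the mean velocity
    sum, w for the quadratic interactions and f for stretching.\<close>
  have e: "- K *\<^sub>R (P *\<^sub>R u - (P * S) *\<^sub>R (r - v) - w) - (P *\<^sub>R (- K *\<^sub>R u) + f + (P * S) *\<^sub>R (- K *\<^sub>R v))
     = (K * (P * S)) *\<^sub>R r + K *\<^sub>R w - f" for K and u r v w f :: "real^3"
    by (simp add: algebra_simps)
  show ?thesis
    unfolding bracket_curl_vexpand[OF k N] bracket_d3_d3_curl_vexpand[OF k N] bracket_d3_vexpand[OF k N] c e
      bracket_stretching q d1
    by (simp add: algebra_simps)
qed

end

section \<open>The vorticity criteria\<close>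

definition defect where
  "defect k c N a = (4 * pi / k * c) *\<^sub>R rot_defect k N a - defect1 k N a *\<^sub>R axis 1 1 + defect2 k N a *\<^sub>R e2"

lemma couplingD:
  assumes "i \<in> Nu" "j \<in> Nu" "coupling i j \<noteq> 0"
  shows "wave1 i = wave1 j" "wave1 j > 0" "phase i = rep2 (phase j + 1)"
  using assms NuD(1)[OF assms(1)] NuD(3)[OF assms(1)] NuD(3)[OF assms(2)]
  by (auto simp: coupling_def rep2_def split: if_splits)

lemma criterion_iD:
  assumes "vorticity_criterion_i N" "i \<in> N" "j \<in> N" "wave1 i = wave1 j" "wave1 j > 0"
    "odd (wave3 i + wave3 j)" "phase i = rep2 (phase j + 1)"
  shows "mode_comp i = 1 \<Longrightarrow> mode_comp j = 1 \<Longrightarrow>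
      (0, \<bar>wave3 i - wave3 j\<bar>, 2, 1) \<in> N \<longleftrightarrow> (0, wave3 i + wave3 j, 2, 1) \<in> N"
    and "mode_comp i = 1 \<Longrightarrow> mode_comp j = 2 \<Longrightarrow>
      (0, wave3 i + wave3 j, 2, 2) \<in> N \<and> (0, \<bar>wave3 i - wave3 j\<bar>, 2, 2) \<in> N"
proof -
  have "(wave1 i, wave3 i, phase i, mode_comp i) \<in> N" "(wave1 j, wave3 j, phase j, mode_comp j) \<in> N"
    using assms(2,3) by (simp_all add: mode_sel_defs)
  note * = assms(1)[unfolded vorticity_criterion_i_def, rule_format, OF conjI[OF this(1) conjI[OF this(2)]]]
  show "mode_comp i = 1 \<Longrightarrow> mode_comp j = 1 \<Longrightarrow>
      (0, \<bar>wave3 i - wave3 j\<bar>, 2, 1) \<in> N \<longleftrightarrow> (0, wave3 i + wave3 j, 2, 1) \<in> N"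
    and "mode_comp i = 1 \<Longrightarrow> mode_comp j = 2 \<Longrightarrow>
      (0, wave3 i + wave3 j, 2, 2) \<in> N \<and> (0, \<bar>wave3 i - wave3 j\<bar>, 2, 2) \<in> N"
    using * assms(4-7) by simp_all
qed

section \<open>Sufficiency: the criteria remove every contribution\<close>

lemma defect1_eq_0:
  assumes N: "N \<subseteq> Nu" and crit: "vorticity_criterion_i N"
  shows "defect1 k N a = 0"
proof -
  have "stream_amp k i * swirl_amp k j * coupling i j *
      (transfer N 2 i j - 2 * of_int (wave3 i) * of_bool (odd (wave3 i + wave3 j))) = 0"
    if "i \<in> N" "j \<in> N" for i j
  proof (cases "stream_amp k i = 0 \<or> swirl_amp k j = 0 \<or> coupling i j = 0")
    case False
    have ij: "i \<in> Nu" "j \<in> Nu" using that N by auto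
    have c: "mode_comp i = 1" "mode_comp j = 2"
      using False NuD(4)[OF ij(2)] by (auto simp: stream_amp_def swirl_amp_def split: if_splits)
    show ?thesis
    proof (cases "odd (wave3 i + wave3 j)")
      case True
      then have "odd \<bar>wave3 i - wave3 j\<bar>" by simp
      with criterion_iD(2)[OF crit that couplingD(1,2)[OF ij] True couplingD(3)[OF ij] c] False True
      show ?thesis by (simp add: transfer_def has_mean_def)
    next
      case even: False
      then have "even \<bar>wave3 i - wave3 j\<bar>" by simp
      with even show ?thesis by (simp add: transfer_def has_mean_def)
    qed
  qed auto
  then show ?thesis unfolding defect1_def by (auto intro!: sum.neutral)
qed

text \<open>The summands need not vanish one by one. When the two membership indicators agree with a
  common value s, b times the transfer is 2 a b s, symmetric in the pair; the antisymmetric coupling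
  then makes the double sum equal to its own negative.\<close>

lemma defect2_eq_0:
  assumes N: "N \<subseteq> Nu" and crit: "vorticity_criterion_i N"
  shows "defect2 k N a = 0"
proof -
  define t where "t i j = stream_amp k i * (stream_amp k j * of_int (wave3 j)) * coupling i j * transfer N 1 i j" for i j
  have anti: "t j i = - t i j" if "i \<in> N" "j \<in> N" for i j
  proof (cases "stream_amp k i = 0 \<or> stream_amp k j = 0 \<or> coupling i j = 0")
    case True
    have "i \<in> Nu" "j \<in> Nu" using that N by auto
    from coupling_sym[OF this] True show ?thesis unfolding t_def by (elim disjE) simp_all
  next
    case False
    have ij: "i \<in> Nu" "j \<in> Nu" using that N by auto
    have c: "mode_comp i = 1" "mode_comp j = 1"
      using False by (auto simp: stream_amp_def split: if_splits)
    have "has_mean N 1 (wave3 i + wave3 j) = has_mean N 1 \<bar>wave3 i - wave3 j\<bar>"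
    proof (cases "odd (wave3 i + wave3 j)")
      case True
      then have "odd \<bar>wave3 i - wave3 j\<bar>" by simp
      with criterion_iD(1)[OF crit that couplingD(1,2)[OF ij] True couplingD(3)[OF ij] c] False True
      show ?thesis by (simp add: has_mean_def)
    next
      case even: False
      then have "even \<bar>wave3 i - wave3 j\<bar>" by simp
      with even show ?thesis by (simp add: has_mean_def)
    qed
    then show ?thesis
      unfolding t_def transfer_def coupling_sym[OF ij]
      by (simp add: algebra_simps abs_minus_commute)
  qed
  have "defect2 k N a = (\<Sum>i\<in>N. \<Sum>j\<in>N. a i * a j * t i j)" by (simp add: defect2_def t_def)
  also have "\<dots> = (\<Sum>i\<in>N. \<Sum>j\<in>N. a j * a i * t j i)" by (rule sum.swap)
  also have "\<dots> = (\<Sum>i\<in>N. \<Sum>j\<in>N. - (a i * a j * t i j))"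
    by (intro sum.cong refl) (subst anti; simp)
  also have "\<dots> = - defect2 k N a" by (simp add: sum_negf defect2_def t_def)
  finally show ?thesis by simp
qed

lemma rot_defect_eq_0:
  assumes N: "N \<subseteq> Nu" and crit: "vorticity_criterion_ii S N" and "S \<noteq> 0"
  shows "rot_defect k N a = 0"
proof -
  have "flip n \<in> N" if "n \<in> N" "odd_mean n" for n
  proof -
    have n: "n = (0, wave3 n, phase n, mode_comp n)" and "odd (wave3 n)"
      using that by (auto simp: mode_eq_iff odd_mean_def)
    moreover have "wave3 n > 0" using that N NuD(7)[of n] by (auto simp: odd_mean_def)
    ultimately have "(0, wave3 n, phase n, rep2 (mode_comp n + 1)) \<in> N"
      using crit \<open>S \<noteq> 0\<close> \<open>n \<in> N\<close> unfolding vorticity_criterion_ii_def by metis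
    then show ?thesis using that by (simp add: flip_def odd_mean_def)
  qed
  then have "{n \<in> N. odd_mean n \<and> flip n \<notin> N} = {}" by auto
  then show ?thesis unfolding rot_defect_def by (simp only: sum.empty)
qed

lemma defect_eq_0:
  assumes "N \<subseteq> Nu" "vorticity_criterion_i N" "vorticity_criterion_ii S N"
  shows "defect k (P * S) N a = 0"
  using defect1_eq_0 defect2_eq_0 rot_defect_eq_0 assms by (cases "S = 0") (auto simp: defect_def)

text \<open>\<open>rot_defect\<close> may point along either axis, so a part can be isolated only
  once the competing ones are known to vanish.\<close>

lemma defect_components:
  assumes "defect k c N a = 0" "(k::real) > 0"
  shows "rot_defect k N a = 0 \<Longrightarrow> defect1 k N a = 0" "rot_defect k N a = 0 \<Longrightarrow> defect2 k N a = 0"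
    "defect1 k N a = 0 \<Longrightarrow> defect2 k N a = 0 \<Longrightarrow> c \<noteq> 0 \<Longrightarrow> rot_defect k N a = 0"
  using assms by (auto simp: defect_def vec_eq_iff forall_3 axis_def)

section \<open>Necessity: test data with one or two modes\<close>

lemma sum_indicator_pair:
  fixes t :: "'a \<Rightarrow> 'a \<Rightarrow> real"
  assumes "finite N" "i \<in> N" "j \<in> N" "i \<noteq> j"
  shows "(\<Sum>x\<in>N. \<Sum>y\<in>N. of_bool (x \<in> {i, j}) * of_bool (y \<in> {i, j}) * t x y) = t i i + t i j + t j i + t j j"
proof -
  have r: "(\<Sum>x\<in>N. of_bool (x \<in> {i, j}) * g x) = g i + g j" for g :: "'a \<Rightarrow> real"
  proof -
    have "(\<Sum>x\<in>N. of_bool (x \<in> {i, j}) * g x) = (\<Sum>x\<in>{i, j}. g x)"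
      using assms by (intro sum.mono_neutral_cong_right) auto
    then show ?thesis using assms by simp
  qed
  have "(\<Sum>x\<in>N. \<Sum>y\<in>N. of_bool (x \<in> {i, j}) * of_bool (y \<in> {i, j}) * t x y)
    = (\<Sum>x\<in>N. of_bool (x \<in> {i, j}) * (\<Sum>y\<in>N. of_bool (y \<in> {i, j}) * t x y))"
    by (simp only: sum_distrib_left mult.assoc)
  then show ?thesis unfolding r by simp
qed

lemma stream_amp_pos: "k > 0 \<Longrightarrow> n \<in> Nu \<Longrightarrow> mode_comp n = 1 \<Longrightarrow> stream_amp k n > 0"
  using NuD(2)[of n] NuD(6)[of n]
  by (auto simp: stream_amp_def eta_def eta1_def Vnorm_def Knorm_def intro!: divide_pos_pos mult_pos_pos add_nonneg_pos)

lemma swirl_amp_pos: "k > 0 \<Longrightarrow> mode_comp n = 2 \<Longrightarrow> swirl_amp k n > 0"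
  by (auto simp: swirl_amp_def eta_def eta1_def Vnorm_def intro!: divide_pos_pos mult_pos_pos)

text \<open>Test with unit amplitude on the mode alone. Self-coupling is zero, so both quadratic
  forms vanish; a missing partner would make \<open>rot_defect\<close> the nonzero vector
  \<open>cos_dir\<close> of this mode.\<close>

lemma criterion_ii_necessary:
  assumes k: "k > 0" and N: "finite N" "N \<subseteq> Nu" and "P > 0"
    and zero: "\<And>a. defect k (P * S) N a = 0"
  shows "vorticity_criterion_ii S N"
  unfolding vorticity_criterion_ii_def
proof (intro impI allI, elim conjE)
  fix m3 p c assume S: "S \<noteq> 0" and m3: "m3 > 0" "odd m3" and n: "(0, m3, p, c) \<in> N"
  define n where "n = (0 :: int, m3, p, c)"
  have nN: "n \<in> N" "odd_mean n" "n \<in> Nu" using n m3 N by (auto simp: n_def odd_mean_def)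
  let ?a = "\<lambda>x. of_bool (x = n) :: real"
  have single: "(\<Sum>x\<in>N. \<Sum>y\<in>N. ?a x * ?a y * t x y) = t n n" for t :: "mode \<Rightarrow> mode \<Rightarrow> real"
  proof -
    have "(\<Sum>x\<in>N. \<Sum>y\<in>N. ?a x * ?a y * t x y) = (\<Sum>x\<in>N. if x = n then (\<Sum>y\<in>N. if y = n then t x y else 0) else 0)"
      by (intro sum.cong refl) (auto intro!: sum.cong simp: sum.neutral)
    then show ?thesis using N nN by simp
  qed
  have "coupling n n = 0" by (simp add: coupling_def)
  then have "defect1 k N ?a = 0" "defect2 k N ?a = 0" unfolding defect1_def defect2_def single by simp_all
  then have rot: "rot_defect k N ?a = 0" using defect_components(3)[OF zero k] S \<open>P > 0\<close> by simp
  show "(0, m3, p, rep2 (c + 1)) \<in> N"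
  proof (rule ccontr)
    assume "(0, m3, p, rep2 (c + 1)) \<notin> N"
    then have "n \<in> {x \<in> N. odd_mean x \<and> flip x \<notin> N}" using nN by (simp add: flip_def n_def)
    then have "rot_defect k N ?a = cos_dir k n"
      unfolding rot_defect_def using N by (subst sum.remove[of _ n]) (auto intro!: sum.neutral)
    then have "mean_amp k *\<^sub>R (if mode_comp n = 1 then axis 1 1 else e2) = (0 :: real^3)"
      using rot cos_dir_mean[of n k] nN by (simp add: odd_mean_def)
    then show False using mean_amp_pos[OF k] by (auto split: if_splits simp: axis_eq_0_iff)
  qed
qed

text \<open>Test with unit amplitudes on i and j. Neither mode is mean, so \<open>rot_defect\<close>
  vanishes and both quadratic forms must be zero; self-couplings vanish, which leaves only the two
  cross terms.\<close>

lemma pair_defect: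
  assumes k: "k > 0" and N: "finite N" "N \<subseteq> Nu" and zero: "\<And>a. defect k c N a = 0"
    and ij: "i \<in> N" "j \<in> N" and w: "wave1 i = wave1 j" "wave1 j > 0" and ph: "phase i \<noteq> phase j"
    and odd: "odd (wave3 i + wave3 j)"
  shows "mode_comp i = 1 \<Longrightarrow> mode_comp j = 1 \<Longrightarrow>
      has_mean N 1 \<bar>wave3 i - wave3 j\<bar> = has_mean N 1 (wave3 i + wave3 j)"
    and "mode_comp i = 1 \<Longrightarrow> mode_comp j = 2 \<Longrightarrow>
      has_mean N 2 (wave3 i + wave3 j) = 1 \<and> has_mean N 2 \<bar>wave3 i - wave3 j\<bar> = 1"
proof -
  have Nu: "i \<in> Nu" "j \<in> Nu" and ne: "i \<noteq> j" using ij N ph by auto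
  have I: "coupling i j \<noteq> 0" "coupling j i = - coupling i j" "coupling i i = 0" "coupling j j = 0"
    using w ph coupling_sym[OF Nu] by (auto simp: coupling_def)
  let ?a = "\<lambda>x. of_bool (x \<in> {i, j}) :: real"
  have "rot_defect k N ?a = 0"
    unfolding rot_defect_def using w by (intro sum.neutral) (auto simp: odd_mean_def)
  then have d: "defect1 k N ?a = 0" "defect2 k N ?a = 0" using defect_components(1,2)[OF zero k] by auto
  note pair = sum_indicator_pair[OF N(1) ij ne]
  show "has_mean N 1 \<bar>wave3 i - wave3 j\<bar> = has_mean N 1 (wave3 i + wave3 j)" if c: "mode_comp i = 1" "mode_comp j = 1"
  proof -
    have "stream_amp k i > 0" "stream_amp k j > 0" using stream_amp_pos k Nu c by auto
    moreover have "stream_amp k i * stream_amp k j * coupling i j *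
        (of_int (wave3 j) * transfer N 1 i j - of_int (wave3 i) * transfer N 1 j i) = 0"
      using d(2) unfolding defect2_def pair I by (simp add: algebra_simps)
    ultimately have "of_int (wave3 j) * transfer N 1 i j - of_int (wave3 i) * transfer N 1 j i = 0"
      using I by simp
    moreover have "transfer N 1 j i = of_int (wave3 j + wave3 i) * has_mean N 1 (wave3 i + wave3 j)
        + of_int (wave3 j - wave3 i) * has_mean N 1 \<bar>wave3 i - wave3 j\<bar>"
      unfolding transfer_def by (metis abs_minus_commute add.commute)
    moreover have "b * ((a + b) * s + (a - b) * d) - a * ((b + a) * s + (b - a) * d) = (a + b) * (a - b) * (d - s)"
      for a b s d :: real by (simp add: algebra_simps)
    ultimately have "of_int ((wave3 i + wave3 j) * (wave3 i - wave3 j)) *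
       (has_mean N 1 \<bar>wave3 i - wave3 j\<bar> - has_mean N 1 (wave3 i + wave3 j)) = 0"
      by (simp only: transfer_def[of N 1 i j] of_int_add of_int_diff of_int_mult)
    \<comment> \<open>Oddness keeps the prefactor (a + b)(a - b) from being zero, so the indicators
      agree.\<close>
    moreover have "odd ((wave3 i + wave3 j) * (wave3 i - wave3 j))" using odd by simp
    then have "(wave3 i + wave3 j) * (wave3 i - wave3 j) \<noteq> 0" by (metis even_zero)
    ultimately show ?thesis by (simp del: of_int_mult)
  qed
  show "has_mean N 2 (wave3 i + wave3 j) = 1 \<and> has_mean N 2 \<bar>wave3 i - wave3 j\<bar> = 1" if c: "mode_comp i = 1" "mode_comp j = 2"
  proof -
    have "stream_amp k i > 0" "swirl_amp k j > 0" "stream_amp k j = 0" using stream_amp_pos swirl_amp_pos k Nu c by (auto simp: stream_amp_def)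
    moreover have "stream_amp k i * swirl_amp k j * coupling i j * (transfer N 2 i j - 2 * of_int (wave3 i)) = 0"
      using d(1) odd unfolding defect1_def pair I \<open>stream_amp k j = 0\<close> by simp
    ultimately have "transfer N 2 i j = 2 * of_int (wave3 i)" using I by simp
    then have t: "of_int (wave3 i + wave3 j) * has_mean N 2 (wave3 i + wave3 j)
       + of_int (wave3 i - wave3 j) * has_mean N 2 \<bar>wave3 i - wave3 j\<bar> = 2 * real_of_int (wave3 i)"
      by (simp add: transfer_def)
    \<comment> \<open>With indicators s, d in {0, 1}, the equation (a + b) s + (a - b) d = 2a
      excludes s = d = 0 by a > 0, s = 1 with d = 0 by a \<noteq> b, and s = 0 with d = 1 by a + b >
      0.\<close>
    have "wave3 i > 0" "wave3 j \<ge> 0" "wave3 i \<noteq> wave3 j"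
      using NuD(2)[OF Nu(1)] NuD(6)[OF Nu(1)] NuD(2)[OF Nu(2)] c odd by (auto simp: order_less_le)
    then have r: "real_of_int (wave3 i) > 0" "real_of_int (wave3 j) \<ge> 0" "real_of_int (wave3 i) \<noteq> real_of_int (wave3 j)"
      by simp_all
    have hm: "has_mean N 2 q = 0 \<or> has_mean N 2 q = 1" for q by (auto simp: has_mean_def)
    show ?thesis
      using hm[of "wave3 i + wave3 j"] hm[of "\<bar>wave3 i - wave3 j\<bar>"]
      by (elim disjE) (use t r in auto)
  qed
qed

lemma criterion_i_necessary:
  assumes k: "k > 0" and N: "finite N" "N \<subseteq> Nu" and zero: "\<And>a. defect k c N a = 0"
  shows "vorticity_criterion_i N"
  unfolding vorticity_criterion_i_def
proof (intro allI impI, elim conjE, intro conjI impI)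
  fix m1' m3' p' c' m1'' m3'' p'' c''
  assume m: "(m1', m3', p', c') \<in> N" "(m1'', m3'', p'', c'') \<in> N" "m1' = m1''" "m1'' > 0"
    "odd (m3' + m3'')" "p' = rep2 (p'' + 1)"
  have p: "p' \<noteq> p''" using m(6) by (auto simp: rep2_def split: if_splits)
  \<comment> \<open>Both orders are needed: \<open>pair_defect\<close> puts component 1 first, while
    the criterion admits (1, 2) and (2, 1).\<close>
  note pd = pair_defect[OF k N zero m(1,2)] pair_defect[OF k N zero m(2,1)]
  have oe: "odd \<bar>m3' - m3''\<bar>" "odd \<bar>m3'' - m3'\<bar>" "odd (m3'' + m3')" using m(5) by simp_all
  show "(0, \<bar>m3' - m3''\<bar>, 2, 1) \<in> N \<longleftrightarrow> (0, m3' + m3'', 2, 1) \<in> N" if "c' = 1 \<and> c'' = 1"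
    using pd(1) m(3-5) p oe that by (simp add: has_mean_def of_bool_eq_iff)
  show "(0, m3' + m3'', 2, 2) \<in> N" "(0, \<bar>m3' - m3''\<bar>, 2, 2) \<in> N" if "(c', c'') \<in> {(1, 2), (2, 1)}"
    using pd(2,4) m(3-5) p oe that
    by (auto simp: has_mean_def add.commute[of m3''] abs_minus_commute[of m3''] split: if_splits)
qed

section \<open>Solutions of the truncated model\<close>

text \<open>This makes derivatives within the time interval unique, including the one-sided
  derivative at 0.\<close>

lemma time_interval_not_bot:
  assumes "t \<in> time_interval T" shows "at t within time_interval T \<noteq> bot"
proof -
  have "ereal t < T" "0 \<le> t" using assms by (auto simp: time_interval_def)
  then obtain s where s: "t < s" "ereal s < T" using ereal_dense2[of "ereal t" T] by auto
  have "{t..s} \<subseteq> time_interval T"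
  proof
    fix r assume "r \<in> {t..s}"
    then have "0 \<le> r" "ereal r \<le> ereal s" using \<open>0 \<le> t\<close> by auto
    with le_less_trans[OF _ s(2), of "ereal r"] show "r \<in> time_interval T" by (simp add: time_interval_def)
  qed
  moreover have "t islimpt {t..s}" using s by simp
  ultimately have "t islimpt time_interval T" by (rule islimpt_subset[rotated])
  then show ?thesis using trivial_limit_within by blast
qed

text \<open>
  The model equation is only imposed on the closed domain; the mean vorticity is determined by the
  boundary values \<open>u(x\<^sub>1, \<pi>) - u(x\<^sub>1, 0)\<close>, so this suffices.
\<close>

lemma bracket_curl_cong_Omega:
  assumes k: "k > 0" and N: "finite N" "N \<subseteq> Nu"
    and eq: "\<And>x. x \<in> Omega k \<Longrightarrow> vexpand k N a x = vexpand k N b x"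
  shows "bracket k (curl (vexpand k N a)) = bracket k (curl (vexpand k N b))"
proof -
  \<comment> \<open>The difference of boundary values carries the factor cos (m pi) - 1, which is -2
    for odd vertical wave number m and 0 otherwise; the period contributes 2 pi / k.\<close>
  let ?J = "\<lambda>c. - (4 * pi / k) *\<^sub>R (\<Sum>n\<in>{n\<in>N. odd_mean n}. c n *\<^sub>R cos_dir k n)"
  have J: "((\<lambda>x. vexpand k N c (x, pi) - vexpand k N c (x, 0)) has_integral ?J c) {0..2 * pi / k}" for c
  proof -
    let ?f = "\<lambda>n x. Xf k n x *\<^sub>R ((cos (of_int (wave3 n) * pi) - 1) *\<^sub>R (c n *\<^sub>R cos_dir k n))"
    have "((\<lambda>x. \<Sum>n\<in>N. ?f n x) has_integral (\<Sum>n\<in>N. (if wave1 n = 0 then 2 * pi / k else 0) *\<^sub>R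
        ((cos (of_int (wave3 n) * pi) - 1) *\<^sub>R (c n *\<^sub>R cos_dir k n)))) {0..2 * pi / k}"
      using N by (intro has_integral_sum has_integral_scaleR_left has_integral_Xf k) auto
    moreover have "(\<Sum>n\<in>N. ?f n x) = vexpand k N c (x, pi) - vexpand k N c (x, 0)" for x
      unfolding vexpand_def vbasis_trig sum_subtractf[symmetric]
    proof (intro sum.cong refl)
      fix n
      have "sin (real_of_int (wave3 n) * pi) = 0" by (simp add: sin_zero_iff_int2)
      then show "?f n x = c n *\<^sub>R trig k n (cos_dir k n) 0 0 (sin_dir k n) (x, pi) - c n *\<^sub>R trig k n (cos_dir k n) 0 0 (sin_dir k n) (x, 0)"
        by (simp add: trig_def algebra_simps)
    qed
    moreover have "(\<Sum>n\<in>N. (if wave1 n = 0 then 2 * pi / k else 0) *\<^sub>R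
        ((cos (of_int (wave3 n) * pi) - 1) *\<^sub>R (c n *\<^sub>R cos_dir k n))) =
        (\<Sum>n\<in>N. if odd_mean n then - (4 * pi / k) *\<^sub>R (c n *\<^sub>R cos_dir k n) else 0)"
      by (intro sum.cong refl) (auto simp: odd_mean_def cos_int_pi)
    moreover have "\<dots> = ?J c"
      unfolding scaleR_sum_right by (simp only: sum.inter_filter[OF N(1)])
    ultimately show ?thesis by (simp only:)
  qed
  have "((\<lambda>x. vexpand k N a (x, pi) - vexpand k N a (x, 0)) has_integral ?J b) {0..2 * pi / k}"
    by (rule has_integral_eq[OF _ J]) (auto simp: eq Omega_def)
  then have "?J a = ?J b" by (rule has_integral_unique[OF J])
  moreover have "bracket k (curl (vexpand k N c)) = curl3 (?J c)" for c
    unfolding bracket_curl_vexpand[OF k N] linear_scale[OF linear_curl3] linear_sum[OF linear_curl3] ..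
  ultimately show ?thesis by (simp only:)
qed

lemma vexpand_has_vector_derivative:
  assumes "\<And>n. n \<in> N \<Longrightarrow> ((\<lambda>s. a s n) has_real_derivative a' n) F"
  shows "((\<lambda>s. vexpand k N (a s) x) has_vector_derivative vexpand k N a' x) F"
proof -
  have "((\<lambda>s. a s n *\<^sub>R vbasis k n x) has_vector_derivative a' n *\<^sub>R vbasis k n x) F" if "n \<in> N" for n
    using assms[OF that] unfolding has_real_derivative_iff_has_vector_derivative
    by (rule bounded_linear.has_vector_derivative[OF bounded_linear_scaleR_left])
  then show ?thesis unfolding vexpand_def by (rule has_vector_derivative_sum)
qed

text \<open>The mean curl is a finite linear combination of the coefficients, so no differentiation
  under the integral is required.\<close>

lemma bracket_curl_has_vector_derivative:
  assumes k: "k > 0" and N: "finite N" "N \<subseteq> Nu"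
    and "t \<in> I" "\<And>s. s \<in> I \<Longrightarrow> u s = vexpand k N (a s)"
    and a: "\<And>n. n \<in> N \<Longrightarrow> ((\<lambda>s. a s n) has_real_derivative a' n) (at t within I)"
  shows "((\<lambda>s. bracket k (curl (u s))) has_vector_derivative bracket k (curl (vexpand k N a'))) (at t within I)"
proof -
  have "((\<lambda>s. - (4 * pi / k) *\<^sub>R (\<Sum>n\<in>{n\<in>N. odd_mean n}. a s n *\<^sub>R curl3 (cos_dir k n))) has_vector_derivative
    - (4 * pi / k) *\<^sub>R (\<Sum>n\<in>{n\<in>N. odd_mean n}. a' n *\<^sub>R curl3 (cos_dir k n))) (at t within I)"
  proof (rule bounded_linear.has_vector_derivative[OF bounded_linear_scaleR_right], rule has_vector_derivative_sum)
    fix n assume "n \<in> {n\<in>N. odd_mean n}"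
    then show "((\<lambda>s. a s n *\<^sub>R curl3 (cos_dir k n)) has_vector_derivative a' n *\<^sub>R curl3 (cos_dir k n)) (at t within I)"
      using a[of n] unfolding has_real_derivative_iff_has_vector_derivative
      by (auto intro: bounded_linear.has_vector_derivative[OF bounded_linear_scaleR_left])
  qed
  then show ?thesis
    unfolding bracket_curl_vexpand[OF k N]
    by (rule has_vector_derivative_transform[rotated 2]) (use assms(4,5) in \<open>auto simp: bracket_curl_vexpand[OF k N]\<close>)
qed

text \<open>Uniqueness of derivatives identifies the expansions with coefficients \<open>a'\<close>
  and \<open>coeff_u\<close> as fields on the domain. This equality passes directly to the mean
  curl, without comparing coefficients, and the vanishing defect does the rest.\<close>

lemma balance_of_criteria:
  assumes k: "k > 0" and N: "finite N" "N \<subseteq> Nu" and M: "finite M"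
    and crit: "vorticity_criterion_i N" "vorticity_criterion_ii S N"
    and sol: "truncated_solution R S P k N M T u th"
  shows "vorticity_balance S P k T u"
  unfolding vorticity_balance_def
proof
  fix t assume t: "t \<in> time_interval T"
  let ?F = "at t within time_interval T"
  obtain a b where ab: "\<And>s. s \<in> time_interval T \<Longrightarrow> u s = vexpand k N (a s)"
      "\<And>s. s \<in> time_interval T \<Longrightarrow> th s = fexpand k M (b s)"
      "\<And>n. n \<in> N \<Longrightarrow> (\<lambda>s. a s n) differentiable ?F"
    using sol t unfolding truncated_solution_def by metis
  then have "\<forall>n\<in>N. \<exists>D. ((\<lambda>s. a s n) has_real_derivative D) ?F"
    by (simp add: real_differentiable_def)
  then obtain a' where a': "\<And>n. n \<in> N \<Longrightarrow> ((\<lambda>s. a s n) has_real_derivative a' n) ?F" by metis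
  let ?c = "coeff_u R S P k N M (a t) (b t)"
  have "vexpand k N a' x = vexpand k N ?c x" if "x \<in> Omega k" for x
  proof -
    have "((\<lambda>s. u s x) has_vector_derivative vexpand k N a' x) ?F"
      by (rule has_vector_derivative_transform[OF t _ vexpand_has_vector_derivative[OF a']]) (simp add: ab)
    moreover have "((\<lambda>s. u s x) has_vector_derivative u_rhs R S P k N (u t) (th t) x) ?F"
      using sol t that unfolding truncated_solution_def by blast
    ultimately have "vexpand k N a' x = u_rhs R S P k N (u t) (th t) x"
      by (rule vector_derivative_unique_within[OF time_interval_not_bot[OF t]])
    then show ?thesis by (simp add: ab t u_rhs_vexpand N M)
  qed
  then have "bracket k (curl (vexpand k N a')) = bracket k (curl (vexpand k N ?c))"
    by (rule bracket_curl_cong_Omega[OF k N])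
  also have "\<dots> = P *\<^sub>R bracket k (d3 (d3 (curl (u t)))) + bracket k (advect (curl (u t)) (u t))
            + (P * S) *\<^sub>R bracket k (d3 (u t))"
    using balance_defect[OF k N, of R S P M "a t" "b t"] defect_eq_0[OF N(2) crit, of k P "a t"]
    by (simp add: ab(1)[OF t] defect_def)
  finally show "((\<lambda>s. bracket k (curl (u s))) has_vector_derivative
      P *\<^sub>R bracket k (d3 (d3 (curl (u t)))) + bracket k (advect (curl (u t)) (u t))
            + (P * S) *\<^sub>R bracket k (d3 (u t))) ?F"
    using bracket_curl_has_vector_derivative[OF k N t ab(1) a'] by simp
qed

text \<open>Velocity and temperature coefficients form one quadratic system over
  \<open>N <+> M\<close>: \<open>Inl\<close> tags velocity modes and \<open>Inr\<close> temperature
  modes. The derivative at 0 is exported because the converse direction evaluates the balance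
  there.\<close>

lemma truncated_model_local_solution:
  assumes N: "finite N" and M: "finite M"
  obtains T :: ereal and a b :: "real \<Rightarrow> mode \<Rightarrow> real" where "T > 0"
    "truncated_solution R S P k N M T (\<lambda>t. vexpand k N (a t)) (\<lambda>t. fexpand k M (b t))"
    "a 0 = a0" "b 0 = b0"
    "\<forall>n\<in>N. ((\<lambda>s. a s n) has_real_derivative coeff_u R S P k N M a0 b0 n) (at 0 within time_interval T)"
proof -
  define A :: "mode + mode \<Rightarrow> mode + mode \<Rightarrow> real" where "A = case_sum
    (\<lambda>n. case_sum (\<lambda>j. (if j = n then - P * ((kappa k n)\<^sup>2 + (of_int (wave3 n))\<^sup>2) else 0) - P * S * rot_u k j n)
                  (\<lambda>j. P * R * buoy_u k j n))
    (\<lambda>n. case_sum (\<lambda>j. lift_th k j n)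
                  (\<lambda>j. if j = n then - ((kappa k n)\<^sup>2 + (of_int (wave3 n))\<^sup>2) else 0))"
  define Q :: "mode + mode \<Rightarrow> mode + mode \<Rightarrow> mode + mode \<Rightarrow> real" where "Q = case_sum
    (\<lambda>n. case_sum (\<lambda>i. case_sum (\<lambda>j. - quad_u k i j n) (\<lambda>j. 0)) (\<lambda>i j. 0))
    (\<lambda>n. case_sum (\<lambda>i. case_sum (\<lambda>j. 0) (\<lambda>j. - quad_th k i j n)) (\<lambda>i j. 0))"
  obtain T y where T: "T > (0::real)" and y0: "y 0 = case_sum a0 b0" and
    y: "\<And>t i. i \<in> N <+> M \<Longrightarrow> \<bar>t\<bar> < T \<Longrightarrow> ((\<lambda>s. y s i) has_real_derivative
       (\<Sum>j\<in>N <+> M. A i j * y t j) + (\<Sum>j\<in>N <+> M. \<Sum>l\<in>N <+> M. Q i j l * (y t j * y t l))) (at t)"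
    by (rule quadratic_ode_local_solution[of "N <+> M" "case_sum a0 b0" A Q]) (use N M in \<open>auto intro: finite_Plus\<close>)
  define a where "a = (\<lambda>t n. y t (Inl n))"
  define b where "b = (\<lambda>t n. y t (Inr n))"
  \<comment> \<open>Separates the diagonal diffusion from the remaining entries in a row of
    \<open>A\<close>.\<close>
  have delta: "(\<Sum>j\<in>I. ((if j = n then d else 0) - c j) * g j) = d * g n - (\<Sum>j\<in>I. c j * g j)"
    if "finite I" "n \<in> I" for I :: "mode set" and n and d :: real and c g
  proof -
    have "(\<Sum>j\<in>I. ((if j = n then d else 0) - c j) * g j) = (\<Sum>j\<in>I. if j = n then d * g n else 0) - (\<Sum>j\<in>I. c j * g j)"
      unfolding sum_subtractf[symmetric] by (intro sum.cong) (auto simp: algebra_simps)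
    then show ?thesis using that by simp
  qed
  have da: "((\<lambda>s. a s n) has_real_derivative coeff_u R S P k N M (a t) (b t) n) (at t within J)"
    if "n \<in> N" "\<bar>t\<bar> < T" for n t J
  proof -
    have "((\<lambda>s. a s n) has_real_derivative
      (\<Sum>j\<in>N <+> M. A (Inl n) j * y t j) + (\<Sum>j\<in>N <+> M. \<Sum>l\<in>N <+> M. Q (Inl n) j l * (y t j * y t l))) (at t within J)"
      unfolding a_def using y[of "Inl n" t] that by (auto intro: has_field_derivative_at_within)
    also have "(\<Sum>j\<in>N <+> M. A (Inl n) j * y t j) =
        (\<Sum>j\<in>N. ((if j = n then - P * ((kappa k n)\<^sup>2 + (of_int (wave3 n))\<^sup>2) else 0) - P * S * rot_u k j n) * a t j)
        + (\<Sum>j\<in>M. P * R * buoy_u k j n * b t j)"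
      by (simp add: sum.Plus[OF N M] A_def a_def b_def)
    also have "(\<Sum>j\<in>N <+> M. \<Sum>l\<in>N <+> M. Q (Inl n) j l * (y t j * y t l)) =
        (\<Sum>i\<in>N. \<Sum>j\<in>N. - (a t i * a t j * quad_u k i j n))"
      by (simp add: sum.Plus[OF N M] Q_def a_def mult_ac)
    also have "(\<Sum>j\<in>N. ((if j = n then - P * ((kappa k n)\<^sup>2 + (of_int (wave3 n))\<^sup>2) else 0) - P * S * rot_u k j n) * a t j)
        + (\<Sum>j\<in>M. P * R * buoy_u k j n * b t j) + (\<Sum>i\<in>N. \<Sum>j\<in>N. - (a t i * a t j * quad_u k i j n))
        = coeff_u R S P k N M (a t) (b t) n"
      unfolding delta[OF N that(1)] coeff_u_def sum_negf sum_distrib_left by (simp add: mult_ac)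
    finally show ?thesis .
  qed
  have db: "((\<lambda>s. b s n) has_real_derivative coeff_th k N M (a t) (b t) n) (at t within J)"
    if "n \<in> M" "\<bar>t\<bar> < T" for n t J
  proof -
    have "((\<lambda>s. b s n) has_real_derivative
      (\<Sum>j\<in>N <+> M. A (Inr n) j * y t j) + (\<Sum>j\<in>N <+> M. \<Sum>l\<in>N <+> M. Q (Inr n) j l * (y t j * y t l))) (at t within J)"
      unfolding b_def using y[of "Inr n" t] that by (auto intro: has_field_derivative_at_within)
    \<comment> \<open>Subtracting 0 gives the diffusion sum the form expected by
      \<open>delta\<close>.\<close>
    also have "(\<Sum>j\<in>N <+> M. A (Inr n) j * y t j) = (\<Sum>j\<in>N. lift_th k j n * a t j)
        + (\<Sum>j\<in>M. ((if j = n then - ((kappa k n)\<^sup>2 + (of_int (wave3 n))\<^sup>2) else 0) - 0) * b t j)"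
      by (simp add: sum.Plus[OF N M] A_def a_def b_def)
    also have "(\<Sum>j\<in>N <+> M. \<Sum>l\<in>N <+> M. Q (Inr n) j l * (y t j * y t l)) =
        (\<Sum>i\<in>N. \<Sum>j\<in>M. - (a t i * b t j * quad_th k i j n))"
      by (simp add: sum.Plus[OF N M] Q_def a_def b_def mult_ac)
    also have "(\<Sum>j\<in>N. lift_th k j n * a t j)
        + (\<Sum>j\<in>M. ((if j = n then - ((kappa k n)\<^sup>2 + (of_int (wave3 n))\<^sup>2) else 0) - 0) * b t j)
        + (\<Sum>i\<in>N. \<Sum>j\<in>M. - (a t i * b t j * quad_th k i j n)) = coeff_th k N M (a t) (b t) n"
      unfolding delta[OF M that(1)] coeff_th_def sum_negf by (simp add: mult_ac)
    finally show ?thesis .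
  qed
  have ti: "\<bar>t\<bar> < T" if "t \<in> time_interval (ereal T)" for t using that by (auto simp: time_interval_def)
  have dfe: "((\<lambda>s. fexpand k M (b s) x) has_real_derivative fexpand k M (coeff_th k N M (a t) (b t)) x) (at t within J)"
    if "\<bar>t\<bar> < T" for t x J
    unfolding fexpand_def using db[OF _ that] by (intro DERIV_sum DERIV_cmult_right) auto
  show ?thesis
  proof
    show "ereal T > 0" using T by simp
    show "a 0 = a0" "b 0 = b0" by (simp_all add: a_def b_def y0)
    then show "\<forall>n\<in>N. ((\<lambda>s. a s n) has_real_derivative coeff_u R S P k N M a0 b0 n) (at 0 within time_interval (ereal T))"
      using da[of _ 0] T by simp
    show "truncated_solution R S P k N M (ereal T) (\<lambda>t. vexpand k N (a t)) (\<lambda>t. fexpand k M (b t))"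
      unfolding truncated_solution_def u_rhs_vexpand[OF N M] th_rhs_fexpand[OF N M]
    proof (rule conjI, rule exI[of _ a], rule exI[of _ b]; intro conjI ballI refl)
      fix t assume t: "t \<in> time_interval (ereal T)"
      show "(\<lambda>s. a s n) differentiable at t within time_interval (ereal T)" if "n \<in> N" for n
        using da[OF that ti[OF t]] real_differentiable_def by blast
      show "(\<lambda>s. b s n) differentiable at t within time_interval (ereal T)" if "n \<in> M" for n
        using db[OF that ti[OF t]] real_differentiable_def by blast
      fix x
      show "((\<lambda>s. vexpand k N (a s) x) has_vector_derivative vexpand k N (coeff_u R S P k N M (a t) (b t)) x)
          (at t within time_interval (ereal T))"
        by (rule vexpand_has_vector_derivative) (rule da[OF _ ti[OF t]])
      show "((\<lambda>s. fexpand k M (b s) x) has_real_derivative fexpand k M (coeff_th k N M (a t) (b t)) x)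
          (at t within time_interval (ereal T))"
        by (rule dfe[OF ti[OF t]])
    qed
  qed
qed

text \<open>Every coefficient vector \<open>a0\<close> is the start of some local solution, here
  with zero temperature. At time 0 the mean vorticity has the derivative given by the coefficient
  system and the one demanded by the balance; uniqueness equates them, and their difference is the
  defect.\<close>

lemma defect_eq_0_of_balance:
  assumes k: "k > 0" and N: "finite N" "N \<subseteq> Nu" and M: "finite M"
    and bal: "\<And>T u th. 0 < T \<Longrightarrow> truncated_solution R S P k N M T u th \<Longrightarrow>
      u 0 \<in> range (vexpand k N) \<Longrightarrow> th 0 \<in> range (fexpand k M) \<Longrightarrow> vorticity_balance S P k T u"
  shows "defect k (P * S) N a0 = 0"
proof -
  obtain T a b where T: "T > 0" and sol: "truncated_solution R S P k N M T (\<lambda>t. vexpand k N (a t)) (\<lambda>t. fexpand k M (b t))"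
    and 0: "a 0 = a0" "b 0 = (\<lambda>_. 0)" and
    da: "\<forall>n\<in>N. ((\<lambda>s. a s n) has_real_derivative coeff_u R S P k N M a0 (\<lambda>_. 0) n) (at 0 within time_interval T)"
    by (rule truncated_model_local_solution[OF N(1) M, of R S P k a0 "\<lambda>_. 0"])
  have t: "0 \<in> time_interval T" using T by (auto simp: time_interval_def zero_ereal_def)
  have "vorticity_balance S P k T (\<lambda>t. vexpand k N (a t))" using T sol by (rule bal) auto
  then have "((\<lambda>s. bracket k (curl (vexpand k N (a s)))) has_vector_derivative
      P *\<^sub>R bracket k (d3 (d3 (curl (vexpand k N a0)))) + bracket k (advect (curl (vexpand k N a0)) (vexpand k N a0))
            + (P * S) *\<^sub>R bracket k (d3 (vexpand k N a0))) (at 0 within time_interval T)"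
    unfolding vorticity_balance_def 0(1)[symmetric] using t by (rule bspec)
  from vector_derivative_unique_within[OF time_interval_not_bot[OF t]
      bracket_curl_has_vector_derivative[OF k N t refl da[rule_format]] this]
  show ?thesis
    using balance_defect[OF k N, of R S P M a0 "\<lambda>_. 0"] by (simp add: defect_def)
qed

theorem proposition2p4:
  fixes R S P k1 :: real and NuM NthM :: "mode set"
  assumes "admissible R S P k1"
    and "finite NuM" and "NuM \<subseteq> Nu"
    and "finite NthM" and "NthM \<subseteq> Ntheta"
  shows "(\<forall>u0 \<in> range (vexpand k1 NuM). \<forall>th0 \<in> range (fexpand k1 NthM).
            \<forall>(T::ereal) u th.
              0 < T \<and> truncated_solution R S P k1 NuM NthM T u th \<and> u 0 = u0 \<and> th 0 = th0
              \<longrightarrow> vorticity_balance S P k1 T u)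
         \<longleftrightarrow> vorticity_criterion_i NuM \<and> vorticity_criterion_ii S NuM"
    (is "?bal \<longleftrightarrow> _")
proof
  have k: "k1 > 0" and P: "P > 0" using assms(1) by (auto simp: admissible_def)
  {
    assume ?bal
    then have "vorticity_balance S P k1 T u"
      if "0 < T" "truncated_solution R S P k1 NuM NthM T u th"
        "u 0 \<in> range (vexpand k1 NuM)" "th 0 \<in> range (fexpand k1 NthM)" for T u th
      using that by blast
    then have "defect k1 (P * S) NuM a = 0" for a
      by (rule defect_eq_0_of_balance[OF k assms(2,3,4)])
    then show "vorticity_criterion_i NuM \<and> vorticity_criterion_ii S NuM"
      using criterion_i_necessary[OF k assms(2,3)] criterion_ii_necessary[OF k assms(2,3) P] by blast
  next
    assume "vorticity_criterion_i NuM \<and> vorticity_criterion_ii S NuM"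
    then show ?bal using balance_of_criteria[OF k assms(2,3,4)] by blast
  }
qed

end
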